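(* Let $t,k,n$ be integers with $2\leq t<k<n$ and $n>k+t\left(\binom{k}{t}-k+t-1\right)$. Let $B$ be a collection of $k$-blocks of $[n]$, and let $p=\binom{n}{t}/\binom{k}{t}$. Let $K$ be a field, let $S=K\left[x_A : A\in\binom{[n]}{t-1}\right]$, and let $M_B^{(t-1)}\subseteq S$ be the $(t-1)$-shadow ideal of $B$. Then $([n],B)$ is an $S(t,k,n)$ if and only if $b_i(S/M_B^{(t-1)})=\binom{p}{i}$ for all $i=0,\ldots,\binom{k}{t-1}-1$.
   Context: $[n]=\{1,\ldots,n\}$. For a set $m$, $\binom{m}{s}$ denotes the collection of all $s$-element subsets of $m$. A $k$-block of $[n]$ is an element of $\binom{[n]}{k}$. A Steiner system $S(t,k,n)$ is a pair $([n],B)$ where $B\subseteq\binom{[n]}{k}$ is such that every $t$-block of $[n]$ is contained in a unique $k$-block in $B$. For $B\subseteq\binom{[n]}{k}$, the $s$-shadow ideal of $B$ is the squarefree monomial ideal $M_B^{(s)}=\left(\prod_{A\in\binom{m}{s}}x_A : m\in B\right)$ of the polynomial ring $S=K\left[x_A : A\in\binom{[n]}{s}\right]$, whose variables are indexed by the $s$-element subsets of $[n]$. For a monomial ideal $M$ of $S$, $b_i(S/M)$ denotes the $i$-th (total) Betti number of $S/M$, i.e. the rank of the free module in homological degree $i$ of the minimal (multigraded) free resolution of $S/M$ over $S$ (homological degree $0$ corresponds to $S$ itself and $b_1$ is the number of minimal generators of $M$). For a possibly non-integer $p$, $\binom{p}{i}=p(p-1)\cdots(p-i+1)/i!$. 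*)

theory Defs
  imports
    Complex_Main
    "HOL-Library.Poly_Mapping"
    "HOL-Library.Ramsey"
    "HOL-Algebra.Ideal"
    "Jordan_Normal_Form.Matrix"
begin

section \<open>Steiner systems\<close>

definition steiner_system :: "nat \<Rightarrow> nat \<Rightarrow> nat \<Rightarrow> nat set set \<Rightarrow> bool" where
  "steiner_system t k n B \<longleftrightarrow>
     B \<subseteq> nsets {1..n} k \<and> (\<forall>T \<in> nsets {1..n} t. \<exists>!b. b \<in> B \<and> T \<subseteq> b)"


section \<open>Polynomial rings and monomial ideals\<close>

text \<open>
  Monomials are finitely supported exponent vectors, polynomials are finitely supported
  coefficient functions on monomials; the multiplication on the type of polynomials is the
  convolution product.  The polynomial ring \<open>K[x\<^sub>v : v \<in> V]\<close> is the subring of those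
  polynomials in which only variables from \<open>V\<close> occur.
\<close>

type_synonym 'v monomial = "'v \<Rightarrow>\<^sub>0 nat"
type_synonym ('v, 'a) mpoly = "'v monomial \<Rightarrow>\<^sub>0 'a"

definition poly_ring :: "'v set \<Rightarrow> ('v, 'a::field) mpoly ring" where
  "poly_ring V = \<lparr>carrier = {f. \<forall>m \<in> Poly_Mapping.keys f. Poly_Mapping.keys m \<subseteq> V},
                  monoid.mult = (*), one = 1, zero = 0, add = (+)\<rparr>"

definition Var :: "'v \<Rightarrow> ('v, 'a::field) mpoly" where
  "Var v = Poly_Mapping.single (Poly_Mapping.single v 1) 1"

definition irrelevant_ideal :: "'v set \<Rightarrow> ('v, 'a::field) mpoly set" where
  "irrelevant_ideal V = Idl\<^bsub>poly_ring V\<^esub> (Var ` V)"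

definition shadow_ideal :: "nat \<Rightarrow> nat \<Rightarrow> nat set set \<Rightarrow> (nat set, 'a::field) mpoly set" where
  "shadow_ideal s n B =
     Idl\<^bsub>poly_ring (nsets {1..n} s)\<^esub> ((\<lambda>m. \<Prod>A \<in> nsets m s. Var A) ` B)"

lemma cring_poly_ring: "cring (poly_ring V :: ('v, 'a::field) mpoly ring)"
proof (rule cringI)
  let ?R = "poly_ring V :: ('v, 'a) mpoly ring"
  show "abelian_group ?R"
  proof (rule abelian_groupI)
    fix f g :: "('v, 'a) mpoly"
    assume "f \<in> carrier ?R" "g \<in> carrier ?R"
    then show "f \<oplus>\<^bsub>?R\<^esub> g \<in> carrier ?R"
      using Poly_Mapping.keys_add[of f g] by (fastforce simp: poly_ring_def)
  next
    fix f :: "('v, 'a) mpoly"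
    assume "f \<in> carrier ?R"
    then show "\<exists>g\<in>carrier ?R. g \<oplus>\<^bsub>?R\<^esub> f = \<zero>\<^bsub>?R\<^esub>"
      by (intro bexI[of _ "- f"]) (auto simp: poly_ring_def)
  qed (auto simp: poly_ring_def ac_simps)
  show "Group.comm_monoid ?R"
  proof (rule comm_monoidI)
    fix f g :: "('v, 'a) mpoly"
    assume fg: "f \<in> carrier ?R" "g \<in> carrier ?R"
    show "f \<otimes>\<^bsub>?R\<^esub> g \<in> carrier ?R"
      unfolding poly_ring_def
    proof (simp, intro ballI)
      fix m assume "m \<in> Poly_Mapping.keys (f * g)"
      then obtain a b where "m = a + b" "a \<in> Poly_Mapping.keys f" "b \<in> Poly_Mapping.keys g"
        using Poly_Mapping.keys_mult[of f g] by blast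
      then show "Poly_Mapping.keys m \<subseteq> V"
        using fg Poly_Mapping.keys_add[of a b] by (fastforce simp: poly_ring_def)
    qed
  qed (auto simp: poly_ring_def ac_simps)
qed (auto simp: poly_ring_def algebra_simps)


section \<open>Minimal multigraded free resolutions and Betti numbers\<close>

text \<open>
  Let \<open>S = K[x\<^sub>v : v \<in> V]\<close>.  A sequence of multigraded free \<open>S\<close>-modules of finite rank with
  homomorphisms between them is given by the rank \<open>rk F i\<close> of the module \<open>F\<^sub>i\<close> in homological
  degree \<open>i\<close>, the multidegree \<open>mdeg F i j\<close> of its \<open>j\<close>-th basis element (\<open>j < rk F i\<close>), and the
  matrix \<open>dif F i\<close> of the map from \<open>F\<^sub>i\<close> to \<open>F\<^sub>i\<^sub>-\<^sub>1\<close>, for \<open>i \<ge> 1\<close>.  The components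
  \<open>dif F 0\<close> and \<open>mdeg F i j\<close> for \<open>j \<ge> rk F i\<close> are irrelevant.
\<close>

record (overloaded) ('v, 'a) free_sequence =
  rk :: "nat \<Rightarrow> nat"
  mdeg :: "nat \<Rightarrow> nat \<Rightarrow> 'v monomial"
  dif :: "nat \<Rightarrow> ('v, 'a) mpoly mat"

definition free_module :: "'v set \<Rightarrow> nat \<Rightarrow> ('v, 'a::field) mpoly vec set" where
  "free_module V r = {v \<in> carrier_vec r. \<forall>j < r. v $ j \<in> carrier (poly_ring V)}"

text \<open>
  A free resolution of \<open>S/M\<close>, for a proper ideal \<open>M\<close>, starting with \<open>F\<^sub>0 = S\<close> and the canonical
  projection from \<open>S\<close> to \<open>S/M\<close>; exactness at \<open>F\<^sub>0\<close> then means that the image of \<open>F\<^sub>1\<close> is \<open>M\<close>.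
\<close>

definition free_resolution ::
  "'v set \<Rightarrow> ('v, 'a::field) mpoly set \<Rightarrow> ('v, 'a) free_sequence \<Rightarrow> bool" where
  "free_resolution V M F \<longleftrightarrow>
     rk F 0 = 1 \<and>
     (\<forall>i. dif F (Suc i) \<in> carrier_mat (rk F i) (rk F (Suc i)) \<and>
          elements_mat (dif F (Suc i)) \<subseteq> carrier (poly_ring V)) \<and>
     (\<lambda>v. (dif F 1 *\<^sub>v v) $ 0) ` free_module V (rk F 1) = M \<and>
     (\<forall>i. {v \<in> free_module V (rk F (Suc i)). dif F (Suc i) *\<^sub>v v = 0\<^sub>v (rk F i)} =
          (\<lambda>v. dif F (Suc (Suc i)) *\<^sub>v v) ` free_module V (rk F (Suc (Suc i))))"

text \<open>
  The maps preserve multidegrees: the entry in row \<open>a\<close> and column \<open>b\<close> is homogeneous of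
  multidegree \<open>mdeg F (i + 1) b - mdeg F i a\<close> (and zero if this is not a monomial).
\<close>

definition multigraded :: "'v set \<Rightarrow> ('v, 'a::field) free_sequence \<Rightarrow> bool" where
  "multigraded V F \<longleftrightarrow>
     mdeg F 0 0 = 0 \<and>
     (\<forall>i. \<forall>j < rk F i. Poly_Mapping.keys (mdeg F i j) \<subseteq> V) \<and>
     (\<forall>i. \<forall>a < rk F i. \<forall>b < rk F (Suc i).
        \<forall>m \<in> Poly_Mapping.keys (dif F (Suc i) $$ (a, b)). m + mdeg F i a = mdeg F (Suc i) b)"

definition minimal :: "'v set \<Rightarrow> ('v, 'a::field) free_sequence \<Rightarrow> bool" where
  "minimal V F \<longleftrightarrow> (\<forall>i. elements_mat (dif F (Suc i)) \<subseteq> irrelevant_ideal V)"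

text \<open>
  \<^term>\<open>betti V M i\<close> is the Betti number \<open>b\<^sub>i(S/M)\<close> of a proper monomial ideal \<open>M\<close> of
  \<open>S = K[x\<^sub>v : v \<in> V]\<close> with \<open>V\<close> finite; minimal multigraded free resolutions exist and are
  unique up to isomorphism, so the rank in homological degree \<open>i\<close> is well defined.
\<close>

definition betti :: "'v set \<Rightarrow> ('v, 'a::field) mpoly set \<Rightarrow> nat \<Rightarrow> nat" where
  "betti V M i =
     (THE b. \<exists>F. free_resolution V M F \<and> multigraded V F \<and> minimal V F \<and> rk F i = b)"

end

theory Submission
  imports Defs "Jordan_Normal_Form.Determinant"
begin

text \<open>
  The Taylor complex \<open>T\<close> on the generators of \<open>M\<close> is a free resolution with
  \<open>rk T\<^sub>i = binom(|B|, i)\<close>. Comparing it, through chain maps that are homotopic to the identity,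
  with a minimal resolution modulo the irrelevant ideal shows two things. If the differentials
  of \<open>T\<close> into and out of degree \<open>i\<close> are minimal, then \<open>b\<^sub>i = binom(|B|, i)\<close>; conversely,
  this equality forces the differential into degree \<open>i\<close> to be minimal, which
  says that the \<open>(t-1)\<close>-shadow of no block is covered by the shadows of \<open>i\<close> other blocks.

  In a Steiner system two blocks share at most one \<open>(t-1)\<close>-set, so at least \<open>binom(k, t-1)\<close> blocks are
  needed to cover the shadow of another one. Conversely \<open>b\<^sub>1 = p\<close> gives \<open>|B| = p\<close>, and if
  fewer than \<open>binom(k, t-1)\<close> blocks never cover another shadow, then counting \<open>t\<close>-sets forces
  every \<open>t\<close>-set to lie in exactly one block.
\<close>


section \<open>Comparison of free resolutions\<close>

text \<open>\<open>betti\<close> is a definite description, so a Betti number can be evaluated only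
  once a minimal multigraded resolution has been exhibited; it is built degree by degree from
  generating sets of syzygies of least cardinality. Because the generators are squarefree, every
  multidegree can be taken to be a set of variables. The minimal and the Taylor resolution are then
  both families of scalar matrices, and exactness is linear algebra for one set of variables at a
  time. The range of i ends where sharing pays off: if b shares a t-set with c, then c covers t
  \<ge> 2 sets in the shadow of b at once, so if the shadow of b is covered at all, binom(k, t-1) -
  1 other blocks suffice. The equalities thus force such a b to own a (t-1)-set that lies in no
  other block. An owner of such a set has a share of at least (k - t + 1) + (n - k)/t of the t-sets,
  and the bound on n says exactly that this exceeds binom(k, t).\<close>

lemma poly_ring_simps:
  "monoid.mult (poly_ring V) = (*)" "one (poly_ring V) = 1" "zero (poly_ring V) = 0" "add (poly_ring V) = (+)"
  by (auto simp: poly_ring_def)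

lemma poly_ring_closed [intro]:
  fixes f g :: "('v, 'a::field) mpoly"
  shows "f \<in> carrier (poly_ring V) \<Longrightarrow> g \<in> carrier (poly_ring V) \<Longrightarrow> f + g \<in> carrier (poly_ring V)"
    and "f \<in> carrier (poly_ring V) \<Longrightarrow> g \<in> carrier (poly_ring V) \<Longrightarrow> f * g \<in> carrier (poly_ring V)"
    and "0 \<in> carrier (poly_ring V :: ('v, 'a) mpoly ring)"
    and "1 \<in> carrier (poly_ring V :: ('v, 'a) mpoly ring)"
    and "f \<in> carrier (poly_ring V) \<Longrightarrow> - f \<in> carrier (poly_ring V)"
proof -
  interpret cring "poly_ring V :: ('v, 'a) mpoly ring" by (rule cring_poly_ring)
  show "f \<in> carrier (poly_ring V) \<Longrightarrow> g \<in> carrier (poly_ring V) \<Longrightarrow> f + g \<in> carrier (poly_ring V)"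
    using a_closed[of f g] by (simp add: poly_ring_simps)
  show "f \<in> carrier (poly_ring V) \<Longrightarrow> g \<in> carrier (poly_ring V) \<Longrightarrow> f * g \<in> carrier (poly_ring V)"
    using m_closed[of f g] by (simp add: poly_ring_simps)
qed (auto simp: poly_ring_def)

lemma poly_ring_diff [intro]:
  "f \<in> carrier (poly_ring V) \<Longrightarrow> g \<in> carrier (poly_ring V) \<Longrightarrow> f - g \<in> carrier (poly_ring V)"
  using poly_ring_closed(1)[of f V "- g"] poly_ring_closed(5)[of g V] by simp

lemma poly_ring_sum [intro]:
  "(\<And>x. x \<in> A \<Longrightarrow> f x \<in> carrier (poly_ring V)) \<Longrightarrow> sum f A \<in> carrier (poly_ring V)"
  by (induction A rule: infinite_finite_induct) (auto intro: poly_ring_closed)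

definition poly_mats :: "'v set \<Rightarrow> nat \<Rightarrow> nat \<Rightarrow> ('v, 'a::field) mpoly mat set" where
  "poly_mats V r c = {A \<in> carrier_mat r c. elements_mat A \<subseteq> carrier (poly_ring V)}"

lemma poly_mats_iff:
  "A \<in> poly_mats V r c \<longleftrightarrow>
     A \<in> carrier_mat r c \<and> (\<forall>i<r. \<forall>j<c. A $$ (i, j) \<in> carrier (poly_ring V))"
proof
  assume "A \<in> poly_mats V r c"
  then show "A \<in> carrier_mat r c \<and> (\<forall>i<r. \<forall>j<c. A $$ (i, j) \<in> carrier (poly_ring V))"
    unfolding poly_mats_def by (blast intro: elements_matI)
next
  assume A: "A \<in> carrier_mat r c \<and> (\<forall>i<r. \<forall>j<c. A $$ (i, j) \<in> carrier (poly_ring V))"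
  then show "A \<in> poly_mats V r c"
    unfolding poly_mats_def by (auto dest!: elements_matD)
qed

lemma poly_mats_carrier [intro, simp]: "A \<in> poly_mats V r c \<Longrightarrow> A \<in> carrier_mat r c"
  by (simp add: poly_mats_def)

lemma poly_mats_mult [intro]:
  "A \<in> poly_mats V r c \<Longrightarrow> B \<in> poly_mats V c e \<Longrightarrow> A * B \<in> poly_mats V r e"
  unfolding poly_mats_iff by (auto simp: scalar_prod_def intro!: poly_ring_sum poly_ring_closed)

lemma poly_mats_minus [intro]:
  "A \<in> poly_mats V r c \<Longrightarrow> B \<in> poly_mats V r c \<Longrightarrow> A - B \<in> poly_mats V r c"
  unfolding poly_mats_iff by (auto intro!: poly_ring_diff)

lemma poly_mats_zero [intro, simp]: "0\<^sub>m r c \<in> poly_mats V r c"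
  unfolding poly_mats_iff by auto

lemma poly_mats_one [intro, simp]: "1\<^sub>m r \<in> poly_mats V r r"
  unfolding poly_mats_iff by auto

lemma free_module_mult_vec [intro]:
  "A \<in> poly_mats V r c \<Longrightarrow> v \<in> free_module V c \<Longrightarrow> A *\<^sub>v v \<in> free_module V r"
  unfolding poly_mats_iff free_module_def
  by (auto simp: scalar_prod_def intro!: poly_ring_sum poly_ring_closed)

text \<open>Free modules are projective: a preimage of each column is chosen separately.\<close>

lemma lift_through_image:
  assumes A: "A \<in> poly_mats V r c" and X: "X \<in> poly_mats V r e"
    and im: "\<And>j. j < e \<Longrightarrow> col X j \<in> (\<lambda>v. A *\<^sub>v v) ` free_module V c"
  obtains Y where "Y \<in> poly_mats V c e" "A * Y = X"
proof -
  have "\<exists>w. w \<in> free_module V c \<and> col X j = A *\<^sub>v w" if "j < e" for j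
    using im[OF that] by auto
  then obtain w where w: "\<And>j. j < e \<Longrightarrow> w j \<in> free_module V c \<and> col X j = A *\<^sub>v w j"
    by metis
  define Y where "Y = mat c e (\<lambda>(i, j). w j $ i)"
  have "Y \<in> poly_mats V c e"
    using w unfolding Y_def poly_mats_iff free_module_def by auto
  moreover have "A * Y = X"
  proof (rule eq_matI)
    fix i j assume ij: "i < dim_row X" "j < dim_col X"
    then have ij': "i < r" "j < e" using X by (auto simp: poly_mats_iff)
    have "col Y j = w j" using w[OF ij'(2)] ij' unfolding Y_def free_module_def by auto
    then have "(A * Y) $$ (i, j) = (A *\<^sub>v w j) $ i"
      using A ij' by (auto simp: poly_mats_iff Y_def)
    also have "\<dots> = X $$ (i, j)" using w[OF ij'(2)] ij by (metis index_col)
    finally show "(A * Y) $$ (i, j) = X $$ (i, j)" .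
  qed (use A X in \<open>auto simp: poly_mats_iff Y_def\<close>)
  ultimately show ?thesis using that by blast
qed

section \<open>Reduction modulo the irrelevant ideal\<close>

definition const_coeff :: "('v, 'a::field) mpoly \<Rightarrow> 'a" where
  "const_coeff f = Poly_Mapping.lookup f 0"

lemma monomial_add_eq_0_iff: "(a :: 'v monomial) + b = 0 \<longleftrightarrow> a = 0 \<and> b = 0"
  by (auto simp: poly_mapping_eq_iff lookup_add fun_eq_iff)

lemma const_coeff_mult: "const_coeff (f * g) = const_coeff f * const_coeff g"
proof -
  have "(\<Sum>q. Poly_Mapping.lookup g q when (0 = l + q)) = (Poly_Mapping.lookup g 0 when l = 0)" for l
  proof -
    have "(\<lambda>q. Poly_Mapping.lookup g q when (0 = l + q)) =
          (\<lambda>q. (Poly_Mapping.lookup g q when l = 0) when q = 0)"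
      using monomial_add_eq_0_iff[of l] by (auto simp: when_def fun_eq_iff)
    then show ?thesis by (simp only: Sum_any_when_equal)
  qed
  then show ?thesis
    unfolding const_coeff_def lookup_mult by (simp add: mult_when)
qed

interpretation const_coeff: comm_ring_hom "const_coeff :: ('v, 'a::field) mpoly \<Rightarrow> 'a"
  by unfold_locales (auto simp: const_coeff_mult, auto simp: const_coeff_def lookup_add lookup_one)

text \<open>The polynomials without constant term form an ideal that contains the variables. Hence
  \<open>const_coeff\<close> kills every entry of a minimal differential.\<close>

lemma const_coeff_irrelevant_ideal:
  assumes "(f :: ('v, 'a::field) mpoly) \<in> irrelevant_ideal V"
  shows "const_coeff f = 0"
proof -
  let ?R = "poly_ring V :: ('v, 'a) mpoly ring"
  interpret R: cring ?R by (rule cring_poly_ring)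
  let ?I = "{f \<in> carrier ?R. const_coeff f = 0}"
  have "additive_subgroup ?I ?R"
  proof (rule additive_subgroup.intro, rule group.subgroupI)
    show "group (add_monoid ?R)" by (rule R.a_group)
    fix a assume a: "a \<in> ?I"
    then have "\<ominus>\<^bsub>?R\<^esub> a = - a"
      by (intro R.minus_equality) (auto simp: poly_ring_simps)
    then show "inv\<^bsub>add_monoid ?R\<^esub> a \<in> ?I"
      using a by (auto simp: a_inv_def const_coeff.hom_uminus)
  qed (auto simp: poly_ring_simps const_coeff.hom_add)
  then have "ideal ?I ?R"
    by (intro idealI R.ring_axioms)
      (auto simp: poly_ring_simps additive_subgroup_def const_coeff.hom_mult)
  moreover have "Poly_Mapping.single x (1::nat) \<noteq> 0" for x :: 'v
    by (metis lookup_single_eq lookup_zero zero_neq_one)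
  then have "Var ` V \<subseteq> ?I"
    by (auto simp: Var_def poly_ring_def const_coeff_def lookup_single_not_eq)
  ultimately show ?thesis
    using assms R.genideal_minimal[of ?I "Var ` V"] unfolding irrelevant_ideal_def by blast
qed

text \<open>If m < n, padding \<open>A\<close> with zero columns and \<open>B\<close> with zero rows
  makes both square without changing the product. The one-sided inverse is then two-sided, yet the
  entry (m, m) of \<open>B' * A'\<close> is 0.\<close>

lemma right_inverse_imp_le:
  assumes A: "(A :: 'a::field mat) \<in> carrier_mat n m" and B: "B \<in> carrier_mat m n"
    and AB: "A * B = 1\<^sub>m n"
  shows "n \<le> m"
proof (rule ccontr)
  assume "\<not> n \<le> m"
  then have nm: "m < n" by simp
  define A' where "A' = mat n n (\<lambda>(i, j). if j < m then A $$ (i, j) else 0)"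
  define B' where "B' = mat n n (\<lambda>(i, j). if i < m then B $$ (i, j) else 0)"
  have "A' * B' = 1\<^sub>m n"
  proof (rule eq_matI)
    fix i j assume ij: "i < dim_row (1\<^sub>m n :: 'a mat)" "j < dim_col (1\<^sub>m n :: 'a mat)"
    have "(A' * B') $$ (i, j) = (\<Sum>l\<in>{0..<n}. if l < m then A $$ (i, l) * B $$ (l, j) else 0)"
      using ij by (auto simp: A'_def B'_def scalar_prod_def intro!: sum.cong)
    also have "\<dots> = (\<Sum>l\<in>{0..<m}. A $$ (i, l) * B $$ (l, j))"
      using nm by (intro sum.mono_neutral_cong_right) auto
    also have "\<dots> = (A * B) $$ (i, j)" using A B ij by (auto simp: scalar_prod_def)
    finally show "(A' * B') $$ (i, j) = 1\<^sub>m n $$ (i, j)" using AB by simp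
  qed (auto simp: A'_def B'_def)
  then have "B' * A' = 1\<^sub>m n"
    by (intro mat_mult_left_right_inverse[of A' n]) (auto simp: A'_def B'_def)
  then have "(B' * A') $$ (m, m) = 1" using nm by simp
  moreover have "(B' * A') $$ (m, m) = 0"
    using nm by (auto simp: A'_def B'_def scalar_prod_def)
  ultimately show False by simp
qed

text \<open>Kernel of the map leaving degree i, where the map leaving degree 0 is the projection of
  S onto S/M. With this convention exactness reads the same in all degrees and one lifting lemma
  serves them all.\<close>

definition augmented_kernel ::
  "'v set \<Rightarrow> ('v, 'a::field) mpoly set \<Rightarrow> ('v, 'a) free_sequence \<Rightarrow> nat \<Rightarrow> ('v, 'a) mpoly vec set" where
  "augmented_kernel V M F i = (case i of 0 \<Rightarrow> {v \<in> free_module V 1. v $ 0 \<in> M}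
     | Suc j \<Rightarrow> {v \<in> free_module V (rk F i). dif F i *\<^sub>v v = 0\<^sub>v (rk F j)})"

context
  fixes V :: "'v set" and M :: "('v, 'a::field) mpoly set" and F :: "('v, 'a) free_sequence"
  assumes F: "free_resolution V M F"
begin

lemma resolution_dif: "dif F (Suc i) \<in> poly_mats V (rk F i) (rk F (Suc i))"
  using F unfolding free_resolution_def poly_mats_def by blast

lemma resolution_rk_0: "rk F 0 = 1"
  using F unfolding free_resolution_def by blast

lemma resolution_exact:
  "augmented_kernel V M F i = (\<lambda>v. dif F (Suc i) *\<^sub>v v) ` free_module V (rk F (Suc i))"
proof (cases i)
  case 0
  have M: "(\<lambda>v. (dif F 1 *\<^sub>v v) $ 0) ` free_module V (rk F 1) = M"
    using F unfolding free_resolution_def by blast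
  have im: "dif F 1 *\<^sub>v v \<in> free_module V 1" if "v \<in> free_module V (rk F 1)" for v
    using resolution_dif[of 0] that resolution_rk_0 by auto
  have "v \<in> (\<lambda>v. dif F 1 *\<^sub>v v) ` free_module V (rk F 1)"
    if v: "v \<in> free_module V 1" "v $ 0 \<in> M" for v
  proof -
    obtain w where w: "w \<in> free_module V (rk F 1)" "v $ 0 = (dif F 1 *\<^sub>v w) $ 0"
      using v(2) M by blast
    have "dim_vec (dif F 1 *\<^sub>v w) = 1" "dim_vec v = 1"
      using v(1) im[OF w(1)] by (simp_all only: free_module_def mem_Collect_eq carrier_vecD)
    then have "v = dif F 1 *\<^sub>v w"
      using w(2) by (intro eq_vecI) (auto simp del: index_mult_mat_vec dim_mult_mat_vec)
    then show ?thesis using w by blast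
  qed
  then show ?thesis using M im by (auto simp: augmented_kernel_def 0)
next
  case (Suc j)
  have "{v \<in> free_module V (rk F (Suc j)). dif F (Suc j) *\<^sub>v v = 0\<^sub>v (rk F j)} =
      (\<lambda>v. dif F (Suc (Suc j)) *\<^sub>v v) ` free_module V (rk F (Suc (Suc j)))"
    using F unfolding free_resolution_def by blast
  then show ?thesis by (simp add: augmented_kernel_def Suc)
qed

lemma resolution_dif_dif:
  "dif F (Suc i) * dif F (Suc (Suc i)) = 0\<^sub>m (rk F i) (rk F (Suc (Suc i)))"
proof (rule eq_matI)
  note D = resolution_dif[of i] resolution_dif[of "Suc i"]
  fix a b
  assume ab: "a < dim_row (0\<^sub>m (rk F i) (rk F (Suc (Suc i))) :: ('v, 'a) mpoly mat)"
    "b < dim_col (0\<^sub>m (rk F i) (rk F (Suc (Suc i))) :: ('v, 'a) mpoly mat)"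
  let ?e = "unit_vec (rk F (Suc (Suc i))) b :: ('v, 'a) mpoly vec"
  have "?e \<in> free_module V (rk F (Suc (Suc i)))"
    by (auto simp: free_module_def unit_vec_def)
  then have "dif F (Suc (Suc i)) *\<^sub>v ?e \<in> augmented_kernel V M F (Suc i)"
    unfolding resolution_exact by blast
  moreover have "dif F (Suc (Suc i)) *\<^sub>v ?e = col (dif F (Suc (Suc i))) b"
    using D ab by (intro eq_vecI) (auto simp: poly_mats_iff)
  ultimately have "dif F (Suc i) *\<^sub>v col (dif F (Suc (Suc i))) b = 0\<^sub>v (rk F i)"
    by (simp add: augmented_kernel_def)
  then have "(dif F (Suc i) *\<^sub>v col (dif F (Suc (Suc i))) b) $ a = 0"
    using ab by simp
  then show "(dif F (Suc i) * dif F (Suc (Suc i))) $$ (a, b) = 0\<^sub>m (rk F i) (rk F (Suc (Suc i))) $$ (a, b)"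
    using D ab by (auto simp: poly_mats_iff)
qed (use resolution_dif[of i] resolution_dif[of "Suc i"] in \<open>auto simp: poly_mats_iff\<close>)

text \<open>The columns of \<open>X\<close> are its values on unit vectors, so the assumption places
  them in the image of the next differential.\<close>

lemma resolution_lift:
  assumes X: "X \<in> poly_mats V (rk F i) e"
    and ker: "\<And>v. v \<in> free_module V e \<Longrightarrow> X *\<^sub>v v \<in> augmented_kernel V M F i"
  obtains Y where "Y \<in> poly_mats V (rk F (Suc i)) e" "dif F (Suc i) * Y = X"
proof (rule lift_through_image[OF resolution_dif X])
  fix j assume j: "j < e"
  have "unit_vec e j \<in> free_module V e" by (auto simp: free_module_def unit_vec_def)
  from ker[OF this] have "X *\<^sub>v unit_vec e j \<in> augmented_kernel V M F i" .
  moreover have "X *\<^sub>v unit_vec e j = col X j"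
    using X j by (intro eq_vecI) (auto simp: poly_mats_iff)
  ultimately show "col X j \<in> (\<lambda>v. dif F (Suc i) *\<^sub>v v) ` free_module V (rk F (Suc i))"
    by (simp add: resolution_exact)
qed

lemma resolution_lift_zero:
  assumes X: "X \<in> poly_mats V (rk F (Suc i)) e" and "dif F (Suc i) * X = 0\<^sub>m (rk F i) e"
  obtains Y where "Y \<in> poly_mats V (rk F (Suc (Suc i))) e" "dif F (Suc (Suc i)) * Y = X"
proof (rule resolution_lift[OF X])
  fix v :: "('v, 'a) mpoly vec" assume v: "v \<in> free_module V e"
  have "dif F (Suc i) *\<^sub>v (X *\<^sub>v v) = (dif F (Suc i) * X) *\<^sub>v v"
    using resolution_dif[of i] X v by (intro assoc_mult_mat_vec[symmetric]) (auto simp: free_module_def)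
  also have "\<dots> = 0\<^sub>v (rk F i)" using v assms(2) by (auto simp: free_module_def)
  finally show "X *\<^sub>v v \<in> augmented_kernel V M F (Suc i)"
    using X v by (auto simp: augmented_kernel_def)
qed

end

text \<open>The identity of S is lifted one degree at a time: the source is free and the target is
  exact.\<close>

lemma chain_map_exists:
  fixes F G :: "('v, 'a::field) free_sequence"
  assumes F: "free_resolution V M F" and G: "free_resolution V M G"
  obtains \<phi> where "\<phi> 0 = 1\<^sub>m 1" "\<And>i. \<phi> i \<in> poly_mats V (rk G i) (rk F i)"
    "\<And>i. dif G (Suc i) * \<phi> (Suc i) = \<phi> i * dif F (Suc i)"
proof -
  \<comment> \<open>That \<open>A\<close> maps augmented kernels into augmented kernels is carried
    along, since it is what puts the image of \<open>A * dif F (Suc i)\<close> into the image of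
    \<open>dif G (Suc i)\<close>.\<close>
  define P where "P i A \<longleftrightarrow> A \<in> poly_mats V (rk G i) (rk F i) \<and> (i = 0 \<longrightarrow> A = 1\<^sub>m 1) \<and>
    (\<forall>v\<in>augmented_kernel V M F i. A *\<^sub>v v \<in> augmented_kernel V M G i)" for i A
  have "P 0 (1\<^sub>m 1)"
    using resolution_rk_0[OF F] resolution_rk_0[OF G]
    by (auto simp: P_def augmented_kernel_def free_module_def)
  moreover have "\<exists>B. P (Suc i) B \<and> dif G (Suc i) * B = A * dif F (Suc i)" if P: "P i A" for i A
  proof -
    have A: "A \<in> poly_mats V (rk G i) (rk F i)" using that by (simp add: P_def)
    note dF = resolution_dif[OF F, of i] and dG = resolution_dif[OF G, of i]
    have AdF: "A * dif F (Suc i) \<in> poly_mats V (rk G i) (rk F (Suc i))"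
      using A dF by blast
    obtain B where B: "B \<in> poly_mats V (rk G (Suc i)) (rk F (Suc i))"
      "dif G (Suc i) * B = A * dif F (Suc i)"
    proof (rule resolution_lift[OF G AdF])
      fix v :: "('v, 'a) mpoly vec" assume v: "v \<in> free_module V (rk F (Suc i))"
      have "A * dif F (Suc i) *\<^sub>v v = A *\<^sub>v (dif F (Suc i) *\<^sub>v v)"
        using A dF v by (intro assoc_mult_mat_vec) (auto simp: free_module_def)
      moreover have "dif F (Suc i) *\<^sub>v v \<in> augmented_kernel V M F i"
        using v by (simp add: resolution_exact[OF F])
      ultimately show "A * dif F (Suc i) *\<^sub>v v \<in> augmented_kernel V M G i"
        using P by (simp add: P_def)
    qed
    have "B *\<^sub>v v \<in> augmented_kernel V M G (Suc i)" if "v \<in> augmented_kernel V M F (Suc i)" for v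
    proof -
      have v: "v \<in> free_module V (rk F (Suc i))" "dif F (Suc i) *\<^sub>v v = 0\<^sub>v (rk F i)"
        using that by (auto simp: augmented_kernel_def)
      then have vc: "v \<in> carrier_vec (rk F (Suc i))" by (simp add: free_module_def)
      have "dif G (Suc i) *\<^sub>v (B *\<^sub>v v) = (dif G (Suc i) * B) *\<^sub>v v"
        using dG B vc by (intro assoc_mult_mat_vec[symmetric]) auto
      also have "\<dots> = A *\<^sub>v (dif F (Suc i) *\<^sub>v v)"
        using A dF vc B by (simp add: assoc_mult_mat_vec[OF poly_mats_carrier poly_mats_carrier])
      also have "\<dots> = 0\<^sub>v (rk G i)"
        using A v by (auto simp: poly_mats_iff)
      finally show ?thesis using B v by (auto simp: augmented_kernel_def)
    qed
    then show ?thesis using B by (auto simp: P_def)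
  qed
  ultimately obtain \<phi> where \<phi>: "\<And>i. P i (\<phi> i)"
    "\<And>i. dif G (Suc i) * \<phi> (Suc i) = \<phi> i * dif F (Suc i)"
    using dependent_nat_choice[of P "\<lambda>i A B. dif G (Suc i) * B = A * dif F (Suc i)"] by blast
  show ?thesis using that[of \<phi>] \<phi> by (simp add: P_def)
qed

text \<open>To be applied to the difference of a chain map and the identity, which vanishes in
  degree 0.\<close>

lemma null_homotopy_exists:
  assumes F: "free_resolution V M F" and \<theta>0: "\<theta> 0 = 0\<^sub>m 1 1"
    and \<theta>: "\<And>i. \<theta> i \<in> poly_mats V (rk F i) (rk F i)"
    and ch: "\<And>i. dif F (Suc i) * \<theta> (Suc i) = \<theta> i * dif F (Suc i)"
  obtains h h' where "h \<in> poly_mats V (rk F (Suc i)) (rk F i)"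
    "h' \<in> poly_mats V (rk F (Suc (Suc i))) (rk F (Suc i))"
    "\<theta> (Suc i) - h * dif F (Suc i) = dif F (Suc (Suc i)) * h'"
proof -
  note d = resolution_dif[OF F]
  \<comment> \<open>The invariant says only that \<open>\<theta> i - dif F (Suc i) * h\<close> kills
    the image of the differential. It replaces the homotopy equation one degree lower and makes
    sense in degree 0 as well, where h = 0 satisfies it.\<close>
  define P where "P i h \<longleftrightarrow> h \<in> poly_mats V (rk F (Suc i)) (rk F i) \<and>
    (\<theta> i - dif F (Suc i) * h) * dif F (Suc i) = 0\<^sub>m (rk F i) (rk F (Suc i))" for i h
  have step: "\<exists>h'. P (Suc i) h' \<and> \<theta> (Suc i) - h * dif F (Suc i) = dif F (Suc (Suc i)) * h'"
    if "P i h" for i h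
  proof -
    have h: "h \<in> poly_mats V (rk F (Suc i)) (rk F i)" using that by (simp add: P_def)
    let ?X = "\<theta> (Suc i) - h * dif F (Suc i)"
    have X: "?X \<in> poly_mats V (rk F (Suc i)) (rk F (Suc i))"
      using \<theta> h d[of i] by blast
    have c: "dif F (Suc i) \<in> carrier_mat (rk F i) (rk F (Suc i))"
      "dif F (Suc (Suc i)) \<in> carrier_mat (rk F (Suc i)) (rk F (Suc (Suc i)))"
      "h \<in> carrier_mat (rk F (Suc i)) (rk F i)" "\<theta> i \<in> carrier_mat (rk F i) (rk F i)"
      "\<theta> (Suc i) \<in> carrier_mat (rk F (Suc i)) (rk F (Suc i))"
      using d[of i] d[of "Suc i"] h \<theta>[of i] \<theta>[of "Suc i"] by blast+
    have "dif F (Suc i) * ?X = dif F (Suc i) * \<theta> (Suc i) - dif F (Suc i) * (h * dif F (Suc i))"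
      using c by (intro mult_minus_distrib_mat) auto
    also have "\<dots> = \<theta> i * dif F (Suc i) - (dif F (Suc i) * h) * dif F (Suc i)"
      using c ch by (simp add: assoc_mult_mat[OF c(1) c(3) c(1)])
    also have "\<dots> = (\<theta> i - dif F (Suc i) * h) * dif F (Suc i)"
      using c by (intro minus_mult_distrib_mat[symmetric]) auto
    also have "\<dots> = 0\<^sub>m (rk F i) (rk F (Suc i))" using that by (simp add: P_def)
    finally obtain h' where h': "h' \<in> poly_mats V (rk F (Suc (Suc i))) (rk F (Suc i))"
      "dif F (Suc (Suc i)) * h' = ?X"
      by (rule resolution_lift_zero[OF F X])
    have "(\<theta> (Suc i) - dif F (Suc (Suc i)) * h') = h * dif F (Suc i)"
      unfolding h'(2) using c by (intro eq_matI) auto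
    then have "(\<theta> (Suc i) - dif F (Suc (Suc i)) * h') * dif F (Suc (Suc i)) =
        h * (dif F (Suc i) * dif F (Suc (Suc i)))"
      using c by (simp add: assoc_mult_mat[OF c(3) c(1) c(2)])
    also have "\<dots> = 0\<^sub>m (rk F (Suc i)) (rk F (Suc (Suc i)))"
      using c by (simp add: resolution_dif_dif[OF F])
    finally show ?thesis using h' by (auto simp: P_def)
  qed
  have "\<exists>h. P i h" for i
  proof (induction i)
    case 0
    have "(\<theta> 0 - dif F (Suc 0) * 0\<^sub>m (rk F (Suc 0)) (rk F 0)) = 0\<^sub>m 1 1"
      using \<theta>0 d[of 0] resolution_rk_0[OF F] by (intro eq_matI) (auto simp: poly_mats_iff)
    then show ?case using d[of 0] resolution_rk_0[OF F]
      by (intro exI[of _ "0\<^sub>m (rk F (Suc 0)) (rk F 0)"]) (auto simp: P_def poly_mats_iff)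
  next
    case (Suc i)
    then show ?case using step by blast
  qed
  then show ?thesis using step that P_def by metis
qed

abbreviation const_mat :: "('v, 'a::field) mpoly mat \<Rightarrow> 'a mat" where
  "const_mat \<equiv> map_mat const_coeff"

lemma const_mat_minus:
  "A \<in> carrier_mat r c \<Longrightarrow> B \<in> carrier_mat r c \<Longrightarrow> const_mat (A - B) = const_mat A - const_mat B"
  by (intro eq_matI) (auto simp: const_coeff.hom_minus)

lemma minus_mat_eq_0D:
  fixes A B :: "'a::group_add mat"
  assumes "A \<in> carrier_mat r c" "B \<in> carrier_mat r c" "A - B = 0\<^sub>m r c"
  shows "A = B"
proof (rule eq_matI)
  fix i j assume "i < dim_row B" "j < dim_col B"
  then show "A $$ (i, j) = B $$ (i, j)"
    using assms(1,2) arg_cong[OF assms(3), of "\<lambda>X. X $$ (i, j)"] by simp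
qed (use assms in auto)

text \<open>A chain map over the identity of \<open>S/M\<close> from \<open>F\<close> to \<open>G\<close> and back is homotopic to the
  identity; modulo the irrelevant ideal the homotopy vanishes where the differentials of \<open>F\<close> do.\<close>
lemma comparison:
  fixes F G :: "('v, 'a::field) free_sequence"
  assumes F: "free_resolution V M F" and G: "free_resolution V M G"
    and minF: "const_mat (dif F (Suc i)) = 0\<^sub>m (rk F i) (rk F (Suc i))"
      "const_mat (dif F (Suc (Suc i))) = 0\<^sub>m (rk F (Suc i)) (rk F (Suc (Suc i)))"
  shows rk_le_of_minimal: "rk F (Suc i) \<le> rk G (Suc i)"
    and minimal_of_rk_eq: "rk F (Suc i) = rk G (Suc i) \<Longrightarrow>
      const_mat (dif G (Suc (Suc i))) = 0\<^sub>m (rk G (Suc i)) (rk G (Suc (Suc i)))"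
proof -
  let ?e = "const_mat :: ('v, 'a) mpoly mat \<Rightarrow> 'a mat"
  obtain \<phi> where \<phi>: "\<phi> 0 = 1\<^sub>m 1" "\<And>i. \<phi> i \<in> poly_mats V (rk G i) (rk F i)"
    "\<And>i. dif G (Suc i) * \<phi> (Suc i) = \<phi> i * dif F (Suc i)"
    using chain_map_exists[OF F G] by blast
  obtain \<psi> where \<psi>: "\<psi> 0 = 1\<^sub>m 1" "\<And>i. \<psi> i \<in> poly_mats V (rk F i) (rk G i)"
    "\<And>i. dif F (Suc i) * \<psi> (Suc i) = \<psi> i * dif G (Suc i)"
    using chain_map_exists[OF G F] by blast
  define \<theta> where "\<theta> i = \<psi> i * \<phi> i - 1\<^sub>m (rk F i)" for i
  have \<theta>: "\<theta> i \<in> poly_mats V (rk F i) (rk F i)" for i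
    unfolding \<theta>_def using \<phi>(2) \<psi>(2) by blast
  have \<theta>0: "\<theta> 0 = 0\<^sub>m 1 1" unfolding \<theta>_def \<phi>(1) \<psi>(1) resolution_rk_0[OF F] by auto
  have cF: "dif F (Suc i) \<in> carrier_mat (rk F i) (rk F (Suc i))" for i
    using resolution_dif[OF F] by blast
  have cG: "dif G (Suc i) \<in> carrier_mat (rk G i) (rk G (Suc i))" for i
    using resolution_dif[OF G] by blast
  have c\<phi>: "\<phi> i \<in> carrier_mat (rk G i) (rk F i)" for i using \<phi>(2) by blast
  have c\<psi>: "\<psi> i \<in> carrier_mat (rk F i) (rk G i)" for i using \<psi>(2) by blast
  have c\<psi>\<phi>: "\<psi> i * \<phi> i \<in> carrier_mat (rk F i) (rk F i)" for i
    by (rule mult_carrier_mat[OF c\<psi> c\<phi>])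
  have "dif F (Suc i) * \<theta> (Suc i) = \<theta> i * dif F (Suc i)" for i
  proof -
    have "dif F (Suc i) * \<theta> (Suc i) =
        dif F (Suc i) * (\<psi> (Suc i) * \<phi> (Suc i)) - dif F (Suc i) * 1\<^sub>m (rk F (Suc i))"
      unfolding \<theta>_def by (rule mult_minus_distrib_mat[OF cF c\<psi>\<phi> one_carrier_mat])
    also have "dif F (Suc i) * (\<psi> (Suc i) * \<phi> (Suc i)) = (\<psi> i * dif G (Suc i)) * \<phi> (Suc i)"
      by (simp add: assoc_mult_mat[OF cF c\<psi> c\<phi>, symmetric] \<psi>(3))
    also have "\<dots> = (\<psi> i * \<phi> i) * dif F (Suc i)"
      by (simp add: assoc_mult_mat[OF c\<psi> cG c\<phi>] assoc_mult_mat[OF c\<psi> c\<phi> cF] \<phi>(3))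
    also have "dif F (Suc i) * 1\<^sub>m (rk F (Suc i)) = 1\<^sub>m (rk F i) * dif F (Suc i)"
      by (simp add: right_mult_one_mat[OF cF] left_mult_one_mat[OF cF])
    also have "\<psi> i * \<phi> i * dif F (Suc i) - 1\<^sub>m (rk F i) * dif F (Suc i) = \<theta> i * dif F (Suc i)"
      unfolding \<theta>_def
      by (rule minus_mult_distrib_mat[OF c\<psi>\<phi> one_carrier_mat cF, symmetric])
    finally show ?thesis .
  qed
  from null_homotopy_exists[OF F \<theta>0 \<theta> this]
  obtain h h' where h: "h \<in> poly_mats V (rk F (Suc i)) (rk F i)"
    "h' \<in> poly_mats V (rk F (Suc (Suc i))) (rk F (Suc i))"
    "\<theta> (Suc i) - h * dif F (Suc i) = dif F (Suc (Suc i)) * h'"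
    by blast
  have ch: "h \<in> carrier_mat (rk F (Suc i)) (rk F i)"
    "h' \<in> carrier_mat (rk F (Suc (Suc i))) (rk F (Suc i))" using h by blast+
  let ?r = "rk F (Suc i)" and ?s = "rk G (Suc i)"
  have e\<theta>: "?e (\<theta> (Suc i)) \<in> carrier_mat ?r ?r" using \<theta> by auto
  \<comment> \<open>Both homotopy terms contain a differential of \<open>F\<close> that reduces to
    0, so the composite of the two chain maps reduces to the identity in degree i + 1.\<close>
  have E1: "?e (\<theta> (Suc i) - h * dif F (Suc i)) = 0\<^sub>m ?r ?r"
    unfolding h(3) const_coeff.mat_hom_mult[OF cF ch(2)] minF using ch by simp
  have E2: "?e (\<theta> (Suc i) - h * dif F (Suc i)) = ?e (\<theta> (Suc i)) - ?e h * ?e (dif F (Suc i))"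
    by (simp only: const_mat_minus[OF poly_mats_carrier[OF \<theta>] mult_carrier_mat[OF ch(1) cF]]
        const_coeff.mat_hom_mult[OF ch(1) cF])
  have E3: "?e h * ?e (dif F (Suc i)) = 0\<^sub>m ?r ?r"
    unfolding minF using ch by simp
  have E4: "?e (\<theta> (Suc i)) = 0\<^sub>m ?r ?r"
    using minus_mat_eq_0D[OF e\<theta> zero_carrier_mat] E1 E2 E3 by argo
  have E5: "?e (\<theta> (Suc i)) = ?e (\<psi> (Suc i)) * ?e (\<phi> (Suc i)) - 1\<^sub>m ?r"
    unfolding \<theta>_def
    by (simp only: const_mat_minus[OF c\<psi>\<phi> one_carrier_mat]
        const_coeff.mat_hom_mult[OF c\<psi> c\<phi>] const_coeff.mat_hom_one)
  have Z: "?e (\<psi> (Suc i)) * ?e (\<phi> (Suc i)) - 1\<^sub>m ?r = 0\<^sub>m ?r ?r"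
    using E4 E5 by argo
  have e\<phi>: "?e (\<phi> (Suc i)) \<in> carrier_mat ?s ?r" and e\<psi>: "?e (\<psi> (Suc i)) \<in> carrier_mat ?r ?s"
    using c\<phi> c\<psi> by auto
  have inv: "?e (\<psi> (Suc i)) * ?e (\<phi> (Suc i)) = 1\<^sub>m ?r"
    by (rule minus_mat_eq_0D[OF mult_carrier_mat[OF e\<psi> e\<phi>] one_carrier_mat Z])
  show "?r \<le> ?s" using right_inverse_imp_le[OF e\<psi> e\<phi> inv] .
  \<comment> \<open>With equal ranks the reduced chain maps are mutually inverse. Commutation with
    the differentials then carries the vanishing of the reduced \<open>dif F\<close> over to
    \<open>dif G\<close>.\<close>
  assume eq: "?r = ?s"
  have inv': "?e (\<phi> (Suc i)) * ?e (\<psi> (Suc i)) = 1\<^sub>m ?s"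
    using mat_mult_left_right_inverse[OF _ _ inv] e\<phi> e\<psi> by (simp add: eq)
  have "?e (\<psi> (Suc i)) * ?e (dif G (Suc (Suc i))) = ?e (dif F (Suc (Suc i))) * ?e (\<psi> (Suc (Suc i)))"
    using const_coeff.mat_hom_mult[OF c\<psi> cG] const_coeff.mat_hom_mult[OF cF c\<psi>] \<psi>(3) by metis
  also have "\<dots> = 0\<^sub>m ?r (rk G (Suc (Suc i)))" 
    unfolding minF by (rule left_mult_zero_mat) (use c\<psi>[of "Suc (Suc i)"] in simp)
  finally have "?e (\<phi> (Suc i)) * (?e (\<psi> (Suc i)) * ?e (dif G (Suc (Suc i)))) =
      0\<^sub>m ?s (rk G (Suc (Suc i)))" using e\<phi> by simp
  moreover have "?e (dif G (Suc (Suc i))) \<in> carrier_mat ?s (rk G (Suc (Suc i)))" using cG by auto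
  ultimately show "?e (dif G (Suc (Suc i))) = 0\<^sub>m ?s (rk G (Suc (Suc i)))"
    using inv' assoc_mult_mat[OF e\<phi> e\<psi>, of "?e (dif G (Suc (Suc i)))" "rk G (Suc (Suc i))"] by simp
qed

lemma minimal_const_mat:
  assumes F: "free_resolution V M F" and "minimal V F"
  shows "const_mat (dif F (Suc i)) = 0\<^sub>m (rk F i) (rk F (Suc i))"
proof -
  have c: "dif F (Suc i) \<in> carrier_mat (rk F i) (rk F (Suc i))" using resolution_dif[OF F] by blast
  have "const_coeff (dif F (Suc i) $$ (a, b)) = 0" if "a < rk F i" "b < rk F (Suc i)" for a b
    using assms(2) c that unfolding minimal_def
    by (meson const_coeff_irrelevant_ideal elements_matI subsetD)
  then show ?thesis using c by (intro eq_matI) auto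
qed

text \<open>Two minimal resolutions bound each other's ranks through
  \<open>rk_le_of_minimal\<close>; in degree 0 the rank is always 1.\<close>

lemma betti_eq_rk:
  assumes F: "free_resolution V M F" "multigraded V F" "minimal V F"
  shows "betti V M i = rk F i"
  unfolding betti_def
proof (rule the_equality)
  show "\<exists>G. free_resolution V M G \<and> multigraded V G \<and> minimal V G \<and> rk G i = rk F i"
    using F by blast
  fix b assume "\<exists>G. free_resolution V M G \<and> multigraded V G \<and> minimal V G \<and> rk G i = b"
  then obtain G where G: "free_resolution V M G" "minimal V G" "rk G i = b" by blast
  show "b = rk F i"
  proof (cases i)
    case 0
    then show ?thesis using resolution_rk_0 F G by metis
  next
    case (Suc j)
    have "rk F (Suc j) = rk G (Suc j)"
      using F G by (intro antisym rk_le_of_minimal minimal_const_mat)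
    then show ?thesis using G Suc by simp
  qed
qed


section \<open>Multigraded maps as scalar matrices\<close>

lemma lookup_single_mult:
  fixes f :: "('v, 'a::field) mpoly"
  shows "Poly_Mapping.lookup (Poly_Mapping.single u c * f) (u + m) = c * Poly_Mapping.lookup f m"
proof -
  have "Poly_Mapping.lookup (Poly_Mapping.single u c * f) (u + m) =
      (\<Sum>l. ((c * (\<Sum>q. Poly_Mapping.lookup f q when (u + m = l + q))) when u = l))"
    unfolding lookup_mult lookup_single by (simp add: when_mult)
  also have "\<dots> = c * (\<Sum>q. Poly_Mapping.lookup f q when (m = q))"
    by simp
  finally show ?thesis by simp
qed

lemma lookup_const_mult:
  fixes f :: "('v, 'a::field) mpoly"
  shows "Poly_Mapping.lookup (Poly_Mapping.single 0 c * f) m = c * Poly_Mapping.lookup f m"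
  using lookup_single_mult[of 0 c f m] by simp

lemma keys_single_mult:
  "m \<in> Poly_Mapping.keys (Poly_Mapping.single u c * (f :: ('v, 'a::field) mpoly)) \<Longrightarrow>
     \<exists>m'\<in>Poly_Mapping.keys f. m = u + m'"
  using keys_mult[of "Poly_Mapping.single u c" f] by (auto split: if_splits)

lemma poly_mapping_expand:
  "f = (\<Sum>m\<in>Poly_Mapping.keys f. Poly_Mapping.single m (Poly_Mapping.lookup f m))"
  by (intro poly_mapping_eqI) (simp add: lookup_sum lookup_single when_def sum.delta not_in_keys_iff_lookup_eq_zero)

definition sqfree_monomial :: "'v set \<Rightarrow> 'v monomial" where
  "sqfree_monomial U = (\<Sum>u\<in>U. Poly_Mapping.single u 1)"

lemma lookup_sqfree_monomial:
  "finite U \<Longrightarrow> Poly_Mapping.lookup (sqfree_monomial U) v = (if v \<in> U then 1 else 0)"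
  by (simp add: sqfree_monomial_def lookup_sum lookup_single when_def)

lemma keys_sqfree_monomial: "finite U \<Longrightarrow> Poly_Mapping.keys (sqfree_monomial U) = U"
  by (auto simp: in_keys_iff lookup_sqfree_monomial split: if_splits)

lemma sqfree_monomial_empty [simp]: "sqfree_monomial {} = 0"
  by (simp add: sqfree_monomial_def)

lemma sqfree_monomial_eq_0_iff: "finite U \<Longrightarrow> sqfree_monomial U = 0 \<longleftrightarrow> U = {}"
  using keys_sqfree_monomial[of U] by auto

lemma sqfree_monomial_diff_add:
  "finite B \<Longrightarrow> A \<subseteq> B \<Longrightarrow> sqfree_monomial (B - A) + sqfree_monomial A = sqfree_monomial B"
  unfolding sqfree_monomial_def by (simp add: sum.subset_diff[of A B])

lemma sqfree_monomial_minus_add: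
  "finite U \<Longrightarrow> U \<subseteq> Poly_Mapping.keys m \<Longrightarrow> sqfree_monomial U + (m - sqfree_monomial U) = m"
  by (intro poly_mapping_eqI)
    (auto simp: lookup_add lookup_minus lookup_sqfree_monomial in_keys_iff Suc_le_eq)

lemma single_in_poly_ring:
  "Poly_Mapping.keys m \<subseteq> V \<Longrightarrow> Poly_Mapping.single m c \<in> carrier (poly_ring V :: ('v, 'a::field) mpoly ring)"
  by (auto simp: poly_ring_def split: if_splits)

abbreviation sqfree_term :: "'v set \<Rightarrow> ('v, 'a::field) mpoly" where
  "sqfree_term U \<equiv> Poly_Mapping.single (sqfree_monomial U) 1"

lemma single_mult_cancel:
  fixes f g :: "('v, 'a::field) mpoly"
  assumes "Poly_Mapping.single u 1 * f = Poly_Mapping.single u 1 * g"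
  shows "f = g"
proof (rule poly_mapping_eqI)
  fix m show "Poly_Mapping.lookup f m = Poly_Mapping.lookup g m"
    using lookup_single_mult[of u 1 f m] lookup_single_mult[of u 1 g m] assms by simp
qed

text \<open>Division is done monomial by monomial. Subtraction of exponents is truncated in general,
  but exact here because \<open>U\<close> lies in the support of every monomial of
  \<open>f\<close>.\<close>

lemma sqfree_term_dvd:
  fixes f :: "('v, 'a::field) mpoly"
  assumes f: "f \<in> carrier (poly_ring V)" and U: "finite U"
    and sub: "\<And>m. m \<in> Poly_Mapping.keys f \<Longrightarrow> U \<subseteq> Poly_Mapping.keys m"
  obtains g where "g \<in> carrier (poly_ring V)" "sqfree_term U * g = f"
proof -
  define g where
    "g = (\<Sum>m\<in>Poly_Mapping.keys f. Poly_Mapping.single (m - sqfree_monomial U) (Poly_Mapping.lookup f m))"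
  have "g \<in> carrier (poly_ring V)" unfolding g_def
  proof (intro poly_ring_sum single_in_poly_ring)
    fix m assume "m \<in> Poly_Mapping.keys f"
    then have "Poly_Mapping.keys m \<subseteq> V" using f by (auto simp: poly_ring_def)
    then show "Poly_Mapping.keys (m - sqfree_monomial U) \<subseteq> V"
      by (auto simp: in_keys_iff lookup_minus)
  qed
  moreover have "sqfree_term U * g = f"
  proof -
    have "sqfree_term U * g =
        (\<Sum>m\<in>Poly_Mapping.keys f. Poly_Mapping.single m (Poly_Mapping.lookup f m))"
      unfolding g_def sum_distrib_left mult_single
      by (intro sum.cong) (auto simp: sqfree_monomial_minus_add[OF U sub])
    then show ?thesis using poly_mapping_expand[of f] by simp
  qed
  ultimately show ?thesis using that by blast
qed

text \<open>The linear combinations themselves form an ideal. This identifies the image of a one-row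
  matrix with the ideal generated by its entries.\<close>

lemma genideal_poly_ring:
  fixes g :: "nat \<Rightarrow> ('v, 'a::field) mpoly"
  assumes g: "\<And>j. j < q \<Longrightarrow> g j \<in> carrier (poly_ring V)"
  shows "Idl\<^bsub>poly_ring V\<^esub> (g ` {..<q}) =
    {(\<Sum>j<q. v j * g j) |v. \<forall>j<q. v j \<in> carrier (poly_ring V)}" (is "_ = ?I")
proof
  let ?R = "poly_ring V :: ('v, 'a) mpoly ring"
  interpret R: cring ?R by (rule cring_poly_ring)
  have sub: "?I \<subseteq> carrier ?R"
    using g by (auto intro!: poly_ring_sum poly_ring_closed)
  have "additive_subgroup ?I ?R"
  proof (rule additive_subgroup.intro, rule group.subgroupI)
    show "group (add_monoid ?R)" by (rule R.a_group)
    have "(\<Sum>j<q. 0 * g j) \<in> ?I" by (intro CollectI exI[of _ "\<lambda>_. 0"]) auto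
    then show "?I \<noteq> {}" by blast
    show "?I \<subseteq> carrier (add_monoid ?R)" using sub by simp
  next
    fix a assume a: "a \<in> ?I"
    then obtain v where v: "a = (\<Sum>j<q. v j * g j)" "\<forall>j<q. v j \<in> carrier ?R" by blast
    have "a \<in> carrier ?R" using a sub by blast
    then have "\<ominus>\<^bsub>?R\<^esub> a = - a"
      by (intro R.minus_equality) (auto simp: poly_ring_simps)
    moreover have "- a = (\<Sum>j<q. (- v j) * g j)" by (simp add: v sum_negf)
    then have "- a \<in> ?I" using v(2) by (intro CollectI exI[of _ "\<lambda>j. - v j"]) auto
    ultimately show "inv\<^bsub>add_monoid ?R\<^esub> a \<in> ?I" by (simp add: a_inv_def)
  next
    fix a b assume "a \<in> ?I" "b \<in> ?I"
    then obtain v w where v: "a = (\<Sum>j<q. v j * g j)" "\<forall>j<q. v j \<in> carrier ?R"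
      and w: "b = (\<Sum>j<q. w j * g j)" "\<forall>j<q. w j \<in> carrier ?R" by blast
    have "a + b = (\<Sum>j<q. (v j + w j) * g j)" by (simp add: v w sum.distrib algebra_simps)
    then have "a + b \<in> ?I" using v(2) w(2) by (intro CollectI exI[of _ "\<lambda>j. v j + w j"]) auto
    then show "a \<otimes>\<^bsub>add_monoid ?R\<^esub> b \<in> ?I" by (simp add: poly_ring_simps)
  qed
  moreover have m: "x * a \<in> ?I" if "a \<in> ?I" "x \<in> carrier ?R" for a x
  proof -
    obtain v where v: "a = (\<Sum>j<q. v j * g j)" "\<forall>j<q. v j \<in> carrier ?R" using \<open>a \<in> ?I\<close> by blast
    have "x * a = (\<Sum>j<q. (x * v j) * g j)" by (simp add: v sum_distrib_left mult.assoc)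
    then show ?thesis using v(2) that(2) by (intro CollectI exI[of _ "\<lambda>j. x * v j"]) auto
  qed
  ultimately have I: "ideal ?I ?R"
  proof (intro idealI R.ring_axioms)
    show "x \<otimes>\<^bsub>?R\<^esub> a \<in> ?I" "a \<otimes>\<^bsub>?R\<^esub> x \<in> ?I" if "a \<in> ?I" "x \<in> carrier ?R" for a x
      using m[OF that] by (simp_all add: poly_ring_simps mult.commute[of a])
  qed (simp add: additive_subgroup_def)
  have "g ` {..<q} \<subseteq> ?I"
  proof
    fix x assume "x \<in> g ` {..<q}"
    then obtain i where i: "i < q" "x = g i" by blast
    have "x = (\<Sum>j<q. (if j = i then 1 else 0) * g j)"
      using i by (simp add: if_distrib[of "\<lambda>z. z * _"] sum.delta cong: if_cong)
    then show "x \<in> ?I" by (intro CollectI exI[of _ "\<lambda>j. if j = i then 1 else 0"]) auto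
  qed
  then show "Idl\<^bsub>?R\<^esub> (g ` {..<q}) \<subseteq> ?I" by (rule R.genideal_minimal[OF I])
  show "?I \<subseteq> Idl\<^bsub>?R\<^esub> (g ` {..<q})"
  proof
    fix x assume "x \<in> ?I"
    then obtain v where v: "x = (\<Sum>j<q. v j * g j)" "\<forall>j<q. v j \<in> carrier ?R" by blast
    have gc: "g ` {..<q} \<subseteq> carrier ?R" using g by blast
    interpret I: ideal "Idl\<^bsub>?R\<^esub> (g ` {..<q})" ?R by (rule R.genideal_ideal[OF gc])
    have "(\<Sum>j\<in>J. v j * g j) \<in> Idl\<^bsub>?R\<^esub> (g ` {..<q})" if "J \<subseteq> {..<q}" "finite J" for J
      using that(2,1)
    proof (induction J rule: finite_induct)
      case empty
      then show ?case using I.zero_closed by (simp add: poly_ring_simps)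
    next
      case (insert j J)
      have "g j \<in> Idl\<^bsub>?R\<^esub> (g ` {..<q})" using R.genideal_self[OF gc] insert.prems by blast
      then have "v j * g j \<in> Idl\<^bsub>?R\<^esub> (g ` {..<q})"
        using I.I_l_closed[of "g j" "v j"] v(2) insert.prems by (simp add: poly_ring_simps)
      then show ?case
        using insert I.a_closed[of "v j * g j" "\<Sum>j\<in>J. v j * g j"] by (simp add: poly_ring_simps)
    qed
    then show "x \<in> Idl\<^bsub>?R\<^esub> (g ` {..<q})" by (simp add: v(1))
  qed
qed

lemma sqfree_term_in_irrelevant_ideal:
  assumes "finite U" "U \<subseteq> V" "U \<noteq> {}"
  shows "Poly_Mapping.single (sqfree_monomial U) c \<in> (irrelevant_ideal V :: ('v, 'a::field) mpoly set)"
proof -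
  let ?R = "poly_ring V :: ('v, 'a) mpoly ring"
  interpret R: cring ?R by (rule cring_poly_ring)
  have Vc: "Var ` V \<subseteq> carrier ?R" by (auto simp: Var_def intro!: single_in_poly_ring split: if_splits)
  interpret I: ideal "Idl\<^bsub>?R\<^esub> (Var ` V)" ?R by (rule R.genideal_ideal[OF Vc])
  obtain u where u: "u \<in> U" using assms by blast
  have "Var u \<in> Idl\<^bsub>?R\<^esub> (Var ` V)" using R.genideal_self[OF Vc] u assms by blast
  moreover have "Poly_Mapping.single (sqfree_monomial (U - {u})) c \<in> carrier ?R"
    using assms by (intro single_in_poly_ring) (auto simp: keys_sqfree_monomial)
  ultimately have "Poly_Mapping.single (sqfree_monomial (U - {u})) c * Var u \<in> Idl\<^bsub>?R\<^esub> (Var ` V)"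
    using I.I_l_closed[of "Var u"] by (simp add: poly_ring_simps)
  moreover have "Poly_Mapping.single (sqfree_monomial (U - {u})) c * Var u =
      Poly_Mapping.single (sqfree_monomial U) c"
    using sqfree_monomial_diff_add[of U "{u}"] assms u
    by (simp add: Var_def mult_single sqfree_monomial_def)
  ultimately show ?thesis by (simp add: irrelevant_ideal_def)
qed

text \<open>After multiplication of the \<open>j\<close>-th basis element by the monomial of its multidegree, a
  multigraded map becomes a matrix of scalars; exactness can thus be tested coefficientwise.\<close>
locale scalar_resolution =
  fixes V :: "'v set" and r :: "nat \<Rightarrow> nat" and W :: "nat \<Rightarrow> nat \<Rightarrow> 'v set"
    and C :: "nat \<Rightarrow> nat \<Rightarrow> nat \<Rightarrow> 'a::field"
  assumes finite_V: "finite V"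
    and r_0: "r 0 = 1" and W_0: "W 0 0 = {}"
    and W_sub: "\<And>i j. j < r i \<Longrightarrow> W i j \<subseteq> V"
    and W_mono: "\<And>i a b. a < r i \<Longrightarrow> b < r (Suc i) \<Longrightarrow> C (Suc i) a b \<noteq> 0 \<Longrightarrow> W i a \<subseteq> W (Suc i) b"
    and C_1: "\<And>j. j < r 1 \<Longrightarrow> C 1 0 j = 1"
    and C_comp: "\<And>i a b. a < r i \<Longrightarrow> b < r (Suc (Suc i)) \<Longrightarrow>
      (\<Sum>j<r (Suc i). C (Suc i) a j * C (Suc (Suc i)) j b) = 0"
    and C_exact: "\<And>i U x. U \<subseteq> V \<Longrightarrow> (\<And>j. x j \<noteq> 0 \<Longrightarrow> j < r (Suc i) \<and> W (Suc i) j \<subseteq> U) \<Longrightarrow>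
      (\<And>a. a < r i \<Longrightarrow> (\<Sum>j<r (Suc i). C (Suc i) a j * x j) = 0) \<Longrightarrow>
      \<exists>y. (\<forall>k. y k \<noteq> 0 \<longrightarrow> k < r (Suc (Suc i)) \<and> W (Suc (Suc i)) k \<subseteq> U) \<and>
        (\<forall>j<r (Suc i). x j = (\<Sum>k<r (Suc (Suc i)). C (Suc (Suc i)) j k * y k))"
begin

text \<open>Wherever the scalar is nonzero, \<open>W_mono\<close> gives containment of the
  multidegrees, so the set difference is the support of their quotient monomial.\<close>

definition sqfree_seq :: "('v, 'a) free_sequence" where
  "sqfree_seq = \<lparr>rk = r, mdeg = \<lambda>i j. sqfree_monomial (W i j),
    dif = \<lambda>i. mat (r (i - 1)) (r i)
      (\<lambda>(a, b). Poly_Mapping.single (sqfree_monomial (W i b - W (i - 1) a)) (C i a b))\<rparr>"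

lemma rk_sq [simp]: "rk sqfree_seq = r"
  by (simp add: sqfree_seq_def)

lemma dif_sq: "dif sqfree_seq (Suc i) = mat (r i) (r (Suc i))
    (\<lambda>(a, b). Poly_Mapping.single (sqfree_monomial (W (Suc i) b - W i a)) (C (Suc i) a b))"
  by (simp add: sqfree_seq_def)

lemma finite_W: "j < r i \<Longrightarrow> finite (W i j)"
  using W_sub finite_V finite_subset by metis

lemma dif_sq_mats: "dif sqfree_seq (Suc i) \<in> poly_mats V (r i) (r (Suc i))"
  unfolding poly_mats_iff dif_sq using finite_W
  by (auto intro!: single_in_poly_ring simp: keys_sqfree_monomial dest: subsetD[OF W_sub])

text \<open>The quotient monomial in the entry cancels against the multidegree of its row and leaves
  that of its column. Rescaling the basis in this way leaves just the scalar matrix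
  \<open>C\<close>.\<close>

lemma shift_dif_sq:
  assumes a: "a < r i" and b: "b < r (Suc i)"
  shows "sqfree_term (W i a) * (dif sqfree_seq (Suc i) $$ (a, b) * f) =
    Poly_Mapping.single 0 (C (Suc i) a b) * (sqfree_term (W (Suc i) b) * f)"
proof (cases "C (Suc i) a b = 0")
  case False
  then have "sqfree_monomial (W i a) + sqfree_monomial (W (Suc i) b - W i a) = sqfree_monomial (W (Suc i) b)"
    using sqfree_monomial_diff_add[of "W (Suc i) b" "W i a"] W_mono a b finite_W
    by (simp add: add.commute)
  then show ?thesis using a b by (simp add: dif_sq mult_single mult.assoc[symmetric])
qed (use a b in \<open>simp add: dif_sq\<close>)

lemma shift_dif_sq_vec:
  assumes a: "a < r i" and v: "v \<in> carrier_vec (r (Suc i))"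
  shows "sqfree_term (W i a) * (dif sqfree_seq (Suc i) *\<^sub>v v) $ a =
    (\<Sum>b<r (Suc i). Poly_Mapping.single 0 (C (Suc i) a b) * (sqfree_term (W (Suc i) b) * v $ b))"
proof -
  have "(dif sqfree_seq (Suc i) *\<^sub>v v) $ a = (\<Sum>b<r (Suc i). dif sqfree_seq (Suc i) $$ (a, b) * v $ b)"
    using dif_sq_mats[of i] a v by (auto simp: poly_mats_iff scalar_prod_def lessThan_atLeast0)
  then show ?thesis using a by (simp add: sum_distrib_left shift_dif_sq)
qed

lemma dif_dif_sq:
  assumes v: "v \<in> free_module V (r (Suc (Suc i)))"
  shows "dif sqfree_seq (Suc i) *\<^sub>v (dif sqfree_seq (Suc (Suc i)) *\<^sub>v v) = 0\<^sub>v (r i)"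
proof (rule eq_vecI)
  have vc: "v \<in> carrier_vec (r (Suc (Suc i)))" using v by (simp add: free_module_def)
  have dv: "dif sqfree_seq (Suc (Suc i)) *\<^sub>v v \<in> carrier_vec (r (Suc i))"
    using free_module_mult_vec[OF dif_sq_mats v] by (simp add: free_module_def)
  fix a assume "a < dim_vec (0\<^sub>v (r i) :: ('v, 'a) mpoly vec)"
  then have a: "a < r i" by simp
  have "sqfree_term (W i a) * (dif sqfree_seq (Suc i) *\<^sub>v (dif sqfree_seq (Suc (Suc i)) *\<^sub>v v)) $ a =
    (\<Sum>b<r (Suc i). \<Sum>k<r (Suc (Suc i)). Poly_Mapping.single 0 (C (Suc i) a b * C (Suc (Suc i)) b k) *
       (sqfree_term (W (Suc (Suc i)) k) * v $ k))"
    unfolding shift_dif_sq_vec[OF a dv]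
    by (intro sum.cong refl, subst shift_dif_sq_vec[OF _ vc])
      (auto simp: sum_distrib_left mult.assoc[symmetric] mult_single)
  also have "\<dots> = (\<Sum>k<r (Suc (Suc i)).
      Poly_Mapping.single 0 (\<Sum>b<r (Suc i). C (Suc i) a b * C (Suc (Suc i)) b k) *
       (sqfree_term (W (Suc (Suc i)) k) * v $ k))"
  proof -
    have s: "Poly_Mapping.single 0 (\<Sum>b\<in>A. h b) = (\<Sum>b\<in>A. Poly_Mapping.single (0::'v monomial) (h b))"
      if "finite A" for A and h :: "nat \<Rightarrow> 'a"
      using that by (induction A) (auto simp: single_add)
    show ?thesis by (subst sum.swap) (simp add: s sum_distrib_right)
  qed
  also have "\<dots> = sqfree_term (W i a) * 0" using C_comp[OF a] by simp
  finally show "(dif sqfree_seq (Suc i) *\<^sub>v (dif sqfree_seq (Suc (Suc i)) *\<^sub>v v)) $ a = 0\<^sub>v (r i) $ a"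
    using a single_mult_cancel by fastforce
qed (simp add: dif_sq)

text \<open>The coefficients of the rescaled vector at a fixed monomial m form a kernel vector of
  \<open>C\<close> supported on basis elements whose multidegree lies in the support of m, so
  \<open>C_exact\<close> applies with that support as \<open>U\<close>. The support condition on the
  solution makes the reassembled polynomials divisible by the multidegrees, which undoes the
  rescaling.\<close>

lemma dif_sq_exact:
  assumes v: "v \<in> free_module V (r (Suc i))" and ker: "dif sqfree_seq (Suc i) *\<^sub>v v = 0\<^sub>v (r i)"
  obtains w where "w \<in> free_module V (r (Suc (Suc i)))" "v = dif sqfree_seq (Suc (Suc i)) *\<^sub>v w"
proof -
  let ?c = "r (Suc i)" and ?e = "r (Suc (Suc i))"
  have vc: "v \<in> carrier_vec ?c" using v by (simp add: free_module_def)
  define v' where "v' j = (if j < ?c then sqfree_term (W (Suc i) j) * v $ j else 0)" for j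
  have v'_carrier: "v' j \<in> carrier (poly_ring V)" for j
    using v finite_W unfolding v'_def free_module_def
    by (auto intro!: poly_ring_closed single_in_poly_ring simp: keys_sqfree_monomial
        dest: subsetD[OF W_sub])
  have v'_keys: "W (Suc i) j \<subseteq> Poly_Mapping.keys m" "j < ?c" "Poly_Mapping.keys m \<subseteq> V"
    if m: "Poly_Mapping.lookup (v' j) m \<noteq> 0" for j m
  proof -
    show j: "j < ?c" using m by (auto simp: v'_def split: if_splits)
    have mk: "m \<in> Poly_Mapping.keys (v' j)" using m by (simp add: in_keys_iff)
    then show "Poly_Mapping.keys m \<subseteq> V" using v'_carrier[of j] by (auto simp: poly_ring_def)
    obtain m' where "m = sqfree_monomial (W (Suc i) j) + m'"
      using mk keys_single_mult unfolding v'_def using j by (metis (full_types))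
    then show "W (Suc i) j \<subseteq> Poly_Mapping.keys m"
      using finite_W[OF j] by (auto simp: in_keys_iff lookup_add lookup_sqfree_monomial)
  qed
  have "\<exists>y. (\<forall>k. y k \<noteq> 0 \<longrightarrow> k < ?e \<and> W (Suc (Suc i)) k \<subseteq> Poly_Mapping.keys m) \<and>
        (\<forall>j<?c. Poly_Mapping.lookup (v' j) m = (\<Sum>k<?e. C (Suc (Suc i)) j k * y k))"
    if mV: "Poly_Mapping.keys m \<subseteq> V" for m
  proof (rule C_exact[OF mV])
    show "j < ?c \<and> W (Suc i) j \<subseteq> Poly_Mapping.keys m" if "Poly_Mapping.lookup (v' j) m \<noteq> 0" for j
      using v'_keys[OF that] by blast
    fix a assume a: "a < r i"
    have "(\<Sum>j<?c. Poly_Mapping.single 0 (C (Suc i) a j) * v' j) = 0"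
      using shift_dif_sq_vec[OF a vc] a unfolding ker v'_def by simp
    then have "Poly_Mapping.lookup (\<Sum>j<?c. Poly_Mapping.single 0 (C (Suc i) a j) * v' j) m = 0"
      by simp
    then show "(\<Sum>j<?c. C (Suc i) a j * Poly_Mapping.lookup (v' j) m) = 0"
      by (simp add: lookup_sum lookup_const_mult)
  qed
  then obtain y where y: "\<And>m k. Poly_Mapping.keys m \<subseteq> V \<Longrightarrow> y m k \<noteq> 0 \<Longrightarrow>
      k < ?e \<and> W (Suc (Suc i)) k \<subseteq> Poly_Mapping.keys m"
    "\<And>m j. Poly_Mapping.keys m \<subseteq> V \<Longrightarrow> j < ?c \<Longrightarrow>
      Poly_Mapping.lookup (v' j) m = (\<Sum>k<?e. C (Suc (Suc i)) j k * y m k)"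
    by metis
  \<comment> \<open>Solutions are kept only at the finitely many monomials that occur in
    \<open>v'\<close>, so that \<open>w'\<close> is a polynomial; elsewhere the right-hand side is
    0.\<close>
  define A where "A = (\<Union>j<?c. Poly_Mapping.keys (v' j))"
  have A: "finite A" "\<And>m. m \<in> A \<Longrightarrow> Poly_Mapping.keys m \<subseteq> V"
    using v'_carrier by (auto simp: A_def poly_ring_def)
  define w' where "w' k = (\<Sum>m\<in>A. Poly_Mapping.single m (y m k))" for k
  have lookup_w': "Poly_Mapping.lookup (w' k) m = (if m \<in> A then y m k else 0)" for k m
    using A(1) by (simp add: w'_def lookup_sum lookup_single when_def)
  have "\<exists>g. g \<in> carrier (poly_ring V) \<and> sqfree_term (W (Suc (Suc i)) k) * g = w' k"
    if k: "k < ?e" for k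
  proof (rule sqfree_term_dvd[of "w' k" V "W (Suc (Suc i)) k"])
    show "w' k \<in> carrier (poly_ring V)"
      using A unfolding w'_def by (auto intro!: poly_ring_sum single_in_poly_ring)
    show "finite (W (Suc (Suc i)) k)" using finite_W k by blast
    fix m assume "m \<in> Poly_Mapping.keys (w' k)"
    then have "m \<in> A" "y m k \<noteq> 0" by (auto simp: in_keys_iff lookup_w' split: if_splits)
    then show "W (Suc (Suc i)) k \<subseteq> Poly_Mapping.keys m" using y(1) A(2) by blast
  qed blast
  then obtain g where g: "\<And>k. k < ?e \<Longrightarrow> g k \<in> carrier (poly_ring V)"
    "\<And>k. k < ?e \<Longrightarrow> sqfree_term (W (Suc (Suc i)) k) * g k = w' k"
    by metis
  let ?w = "vec ?e g"
  have w: "?w \<in> free_module V ?e" using g by (auto simp: free_module_def)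
  have "v = dif sqfree_seq (Suc (Suc i)) *\<^sub>v ?w"
  proof (rule eq_vecI)
    fix j assume "j < dim_vec (dif sqfree_seq (Suc (Suc i)) *\<^sub>v ?w)"
    then have j: "j < ?c" by (simp add: dif_sq)
    have "sqfree_term (W (Suc i) j) * (dif sqfree_seq (Suc (Suc i)) *\<^sub>v ?w) $ j =
        (\<Sum>k<?e. Poly_Mapping.single 0 (C (Suc (Suc i)) j k) * w' k)"
      by (subst shift_dif_sq_vec[OF j]) (auto simp: g)
    also have "\<dots> = v' j"
    proof (rule poly_mapping_eqI)
      fix m
      have "Poly_Mapping.lookup (\<Sum>k<?e. Poly_Mapping.single 0 (C (Suc (Suc i)) j k) * w' k) m =
          (\<Sum>k<?e. C (Suc (Suc i)) j k * (if m \<in> A then y m k else 0))"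
        by (simp add: lookup_sum lookup_const_mult lookup_w')
      also have "\<dots> = Poly_Mapping.lookup (v' j) m"
      proof (cases "m \<in> A")
        case True
        then show ?thesis using y(2)[OF A(2) j] by simp
      next
        case False
        then have "Poly_Mapping.lookup (v' j) m = 0" using j by (auto simp: A_def in_keys_iff)
        then show ?thesis using False by simp
      qed
      finally show "Poly_Mapping.lookup (\<Sum>k<?e. Poly_Mapping.single 0 (C (Suc (Suc i)) j k) * w' k) m =
        Poly_Mapping.lookup (v' j) m" .
    qed
    also have "\<dots> = sqfree_term (W (Suc i) j) * v $ j" using j by (simp add: v'_def)
    finally show "v $ j = (dif sqfree_seq (Suc (Suc i)) *\<^sub>v ?w) $ j"
      using single_mult_cancel by metis
  qed (use vc in \<open>simp add: dif_sq\<close>)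
  then show ?thesis using that w by blast
qed

lemma image_dif_sq_1:
  "(\<lambda>v. (dif sqfree_seq 1 *\<^sub>v v) $ 0) ` free_module V (r 1) =
     Idl\<^bsub>poly_ring V\<^esub> ((\<lambda>j. sqfree_term (W 1 j)) ` {..<r 1})"
proof -
  have ev: "(dif sqfree_seq 1 *\<^sub>v v) $ 0 = (\<Sum>j<r 1. v $ j * sqfree_term (W 1 j))"
    if "v \<in> carrier_vec (r 1)" for v
  proof -
    have "sqfree_term (W 0 0) * (dif sqfree_seq (Suc 0) *\<^sub>v v) $ 0 =
        (\<Sum>b<r 1. Poly_Mapping.single 0 (C 1 0 b) * (sqfree_term (W 1 b) * v $ b))"
      using shift_dif_sq_vec[of 0 0 v] r_0 that by simp
    also have "\<dots> = (\<Sum>j<r 1. v $ j * sqfree_term (W 1 j))"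
      using C_1 by (intro sum.cong) (auto simp: mult.commute)
    finally show ?thesis by (simp add: W_0)
  qed
  have "(\<lambda>v. (dif sqfree_seq 1 *\<^sub>v v) $ 0) ` free_module V (r 1) =
     {(\<Sum>j<r 1. v j * sqfree_term (W 1 j)) |v. \<forall>j<r 1. v j \<in> carrier (poly_ring V)}"
    (is "?L = ?R")
  proof
    show "?L \<subseteq> ?R" using ev by (auto simp: free_module_def)
    show "?R \<subseteq> ?L"
    proof
      fix x assume "x \<in> ?R"
      then obtain v where v: "x = (\<Sum>j<r 1. v j * sqfree_term (W 1 j))"
        "\<forall>j<r 1. v j \<in> carrier (poly_ring V)" by blast
      then have "x = (dif sqfree_seq 1 *\<^sub>v vec (r 1) v) $ 0" by (subst ev) auto
      moreover have "vec (r 1) v \<in> free_module V (r 1)" using v by (auto simp: free_module_def)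
      ultimately show "x \<in> ?L" by blast
    qed
  qed
  also have "\<dots> = Idl\<^bsub>poly_ring V\<^esub> ((\<lambda>j. sqfree_term (W 1 j)) ` {..<r 1})"
    using W_sub finite_W
    by (intro genideal_poly_ring[symmetric] single_in_poly_ring) (auto simp: keys_sqfree_monomial)
  finally show ?thesis .
qed

lemma free_resolution_sq:
  "free_resolution V (Idl\<^bsub>poly_ring V\<^esub> ((\<lambda>j. sqfree_term (W 1 j)) ` {..<r 1})) sqfree_seq"
proof -
  have "{v \<in> free_module V (r (Suc i)). dif sqfree_seq (Suc i) *\<^sub>v v = 0\<^sub>v (r i)} =
      (\<lambda>v. dif sqfree_seq (Suc (Suc i)) *\<^sub>v v) ` free_module V (r (Suc (Suc i)))" (is "?L = ?R") for i
  proof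
    show "?L \<subseteq> ?R" using dif_sq_exact by blast
    show "?R \<subseteq> ?L" using dif_dif_sq free_module_mult_vec[OF dif_sq_mats] by blast
  qed
  then show ?thesis
    using image_dif_sq_1 dif_sq_mats r_0 unfolding free_resolution_def poly_mats_def rk_sq
    by blast
qed

lemma multigraded_sq: "multigraded V sqfree_seq"
  unfolding multigraded_def
proof (intro conjI allI impI ballI)
  show "mdeg sqfree_seq 0 0 = 0" by (simp add: sqfree_seq_def W_0)
  show "Poly_Mapping.keys (mdeg sqfree_seq i j) \<subseteq> V" if "j < rk sqfree_seq i" for i j
    using that W_sub finite_W by (simp add: sqfree_seq_def keys_sqfree_monomial)
  fix i a b m
  assume ab: "a < rk sqfree_seq i" "b < rk sqfree_seq (Suc i)" and m: "m \<in> Poly_Mapping.keys (dif sqfree_seq (Suc i) $$ (a, b))"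
  then have "C (Suc i) a b \<noteq> 0" "m = sqfree_monomial (W (Suc i) b - W i a)"
    by (auto simp: dif_sq split: if_splits)
  then show "m + mdeg sqfree_seq i a = mdeg sqfree_seq (Suc i) b"
    using ab by (auto simp: sqfree_seq_def intro!: sqfree_monomial_diff_add finite_W dest: subsetD[OF W_mono])
qed

lemma minimal_sq:
  assumes "\<And>i a b. a < r i \<Longrightarrow> b < r (Suc i) \<Longrightarrow> C (Suc i) a b \<noteq> 0 \<Longrightarrow> W i a \<noteq> W (Suc i) b"
  shows "minimal V sqfree_seq"
  unfolding minimal_def
proof (intro allI subsetI)
  fix i x assume "x \<in> elements_mat (dif sqfree_seq (Suc i))"
  then obtain a b where ab: "a < r i" "b < r (Suc i)" and x: "x = dif sqfree_seq (Suc i) $$ (a, b)"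
    using elements_matD by (fastforce simp: dif_sq)
  show "x \<in> irrelevant_ideal V"
  proof (cases "C (Suc i) a b = 0")
    case False
    then have "W (Suc i) b - W i a \<noteq> {}" using assms W_mono ab by blast
    then show ?thesis
      using ab W_sub[OF ab(2)] finite_W[OF ab(2)]
      by (auto simp: x dif_sq intro!: sqfree_term_in_irrelevant_ideal)
  next
    case True
    interpret cring "poly_ring V :: ('v, 'a) mpoly ring" by (rule cring_poly_ring)
    have "ideal (irrelevant_ideal V) (poly_ring V :: ('v, 'a) mpoly ring)"
      unfolding irrelevant_ideal_def
      by (rule genideal_ideal) (auto simp: Var_def intro!: single_in_poly_ring split: if_splits)
    then interpret I: ideal "irrelevant_ideal V" "poly_ring V :: ('v, 'a) mpoly ring" .
    show ?thesis using I.zero_closed True ab by (simp add: x dif_sq poly_ring_simps)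
  qed
qed

text \<open>An entry has a nonzero constant term precisely when a nonzero scalar joins two equal
  multidegrees, the quotient monomial being 1.\<close>

lemma const_mat_dif_sq:
  "const_mat (dif sqfree_seq (Suc i)) = 0\<^sub>m (r i) (r (Suc i)) \<longleftrightarrow>
    (\<forall>a<r i. \<forall>b<r (Suc i). C (Suc i) a b \<noteq> 0 \<longrightarrow> W i a \<noteq> W (Suc i) b)"
proof -
  have "const_coeff (dif sqfree_seq (Suc i) $$ (a, b)) = 0 \<longleftrightarrow> (C (Suc i) a b \<noteq> 0 \<longrightarrow> W i a \<noteq> W (Suc i) b)"
    if "a < r i" "b < r (Suc i)" for a b
    using that W_mono[OF that] finite_W[OF that(2)]
      sqfree_monomial_eq_0_iff[of "W (Suc i) b - W i a"]
    by (auto simp: dif_sq const_coeff_def lookup_single when_def)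
  then show ?thesis
    using dif_sq_mats[of i] by (auto simp: mat_eq_iff poly_mats_iff)
qed

end


section \<open>Existence of minimal resolutions\<close>

text \<open>The kernel in the squarefree degree \<open>U\<close>, in rescaled coordinates. The
  equation is imposed on every row index; in the matrices built below, rows beyond the rank of the
  target vanish.\<close>

definition solves :: "nat \<Rightarrow> (nat \<Rightarrow> 'v set) \<Rightarrow> (nat \<Rightarrow> nat \<Rightarrow> 'a::field) \<Rightarrow> 'v set \<Rightarrow> (nat \<Rightarrow> 'a) \<Rightarrow> bool" where
  "solves c \<beta> C U x \<longleftrightarrow> (\<forall>j. x j \<noteq> 0 \<longrightarrow> j < c \<and> \<beta> j \<subseteq> U) \<and> (\<forall>i. (\<Sum>j<c. C i j * x j) = 0)"

text \<open>The kernel of the map is contained in the multiples of the irrelevant ideal.\<close>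
definition tight :: "nat \<Rightarrow> (nat \<Rightarrow> 'v set) \<Rightarrow> (nat \<Rightarrow> nat \<Rightarrow> 'a::field) \<Rightarrow> bool" where
  "tight c \<beta> C \<longleftrightarrow> (\<forall>U x j. solves c \<beta> C U x \<longrightarrow> j < c \<longrightarrow> \<beta> j = U \<longrightarrow> x j = 0)"

text \<open>A generator is stored as a degree with a kernel vector. Its coefficient
  \<open>y p\<close> is a mere scalar because the monomial factor is dictated by the degrees
  \<open>U\<close> and \<open>fst p\<close>.\<close>

definition syzygy_generators ::
  "nat \<Rightarrow> (nat \<Rightarrow> 'v set) \<Rightarrow> (nat \<Rightarrow> nat \<Rightarrow> 'a::field) \<Rightarrow> 'v set \<Rightarrow> ('v set \<times> (nat \<Rightarrow> 'a)) set \<Rightarrow> bool" where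
  "syzygy_generators c \<beta> C V G \<longleftrightarrow> finite G \<and> (\<forall>p\<in>G. fst p \<subseteq> V \<and> solves c \<beta> C (fst p) (snd p)) \<and>
     (\<forall>U x. solves c \<beta> C U x \<longrightarrow>
       (\<exists>y. (\<forall>p. y p \<noteq> 0 \<longrightarrow> p \<in> G \<and> fst p \<subseteq> U) \<and> (\<forall>j. x j = (\<Sum>p\<in>G. y p * snd p j))))"

text \<open>Only finitely many supports \<open>J\<close> occur, and one kernel vector per support
  suffices. Its degree is the union of \<open>\<beta>\<close> over \<open>J\<close>, the least
  degree in which it lives, so it is available wherever some kernel vector has support
  \<open>J\<close>.\<close>

lemma syzygy_generators_exist:
  fixes C :: "nat \<Rightarrow> nat \<Rightarrow> 'a::field"
  assumes \<beta>: "\<And>j. j < c \<Longrightarrow> \<beta> j \<subseteq> V"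
  shows "\<exists>G. syzygy_generators c \<beta> C V G"
proof -
  define S where "S J x \<longleftrightarrow> {j. x j \<noteq> 0} = J \<and> (\<forall>i. (\<Sum>j<c. C i j * x j) = 0)" for J x
  define Js where "Js = {J. J \<subseteq> {..<c} \<and> (\<exists>x. S J x)}"
  define e where "e J = (SOME x. S J x)" for J
  have e: "S J (e J)" if "J \<in> Js" for J
    using that someI_ex[of "S J"] unfolding Js_def e_def by blast
  define G where "G = (\<lambda>J. (\<Union>j\<in>J. \<beta> j, e J)) ` Js"
  have fin: "finite G" unfolding G_def Js_def by simp
  have gen: "\<exists>y. (\<forall>p. y p \<noteq> 0 \<longrightarrow> p \<in> G \<and> fst p \<subseteq> U) \<and> (\<forall>j. x j = (\<Sum>p\<in>G. y p * snd p j))"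
    if "solves c \<beta> C U x" for U x
    using that
  proof (induction "card {j. x j \<noteq> 0}" arbitrary: x rule: less_induct)
    case less
    define J where "J = {j. x j \<noteq> 0}"
    have Jc: "J \<subseteq> {..<c}" and JU: "\<And>j. j \<in> J \<Longrightarrow> \<beta> j \<subseteq> U"
      using less.prems by (auto simp: J_def solves_def)
    have finJ: "finite J" using Jc finite_subset by blast
    show ?case
    proof (cases "J = {}")
      case True
      then show ?thesis by (intro exI[of _ "\<lambda>_. 0"]) (auto simp: J_def)
    next
      case False
      then obtain j0 where j0: "j0 \<in> J" by blast
      have "J \<in> Js" using Jc less.prems by (auto simp: Js_def S_def J_def solves_def)
      then have eJ: "S J (e J)" by (rule e)
      define p where "p = (\<Union>j\<in>J. \<beta> j, e J)"
      have pG: "p \<in> G" using \<open>J \<in> Js\<close> by (auto simp: G_def p_def)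
      have pU: "fst p \<subseteq> U" using JU by (auto simp: p_def)
      \<comment> \<open>Chosen to cancel the coordinate \<open>j0\<close>. Since \<open>e J\<close>
        has the same support as \<open>x\<close>, the support strictly shrinks.\<close>
      define l where "l = x j0 / e J j0"
      define x' where "x' j = x j - l * e J j" for j
      have ne: "e J j0 \<noteq> 0" using eJ j0 by (auto simp: S_def)
      have supp: "{j. x' j \<noteq> 0} \<subseteq> J - {j0}"
        using eJ ne by (auto simp: x'_def l_def S_def J_def)
      have "{j. x' j \<noteq> 0} \<subset> J" using supp j0 by blast
      then have "card {j. x' j \<noteq> 0} < card J" using finJ by (rule psubset_card_mono[rotated])
      moreover have "solves c \<beta> C U x'"
        unfolding solves_def
      proof (intro conjI allI impI)
        fix j assume "x' j \<noteq> 0"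
        then have "j \<in> J" using supp by blast
        then show "j < c" "\<beta> j \<subseteq> U" using Jc JU by auto
      next
        fix i
        have "(\<Sum>j<c. C i j * x' j) = (\<Sum>j<c. C i j * x j) - l * (\<Sum>j<c. C i j * e J j)"
          by (simp add: x'_def algebra_simps sum_subtractf sum_distrib_left)
        then show "(\<Sum>j<c. C i j * x' j) = 0"
          using less.prems eJ by (simp add: solves_def S_def)
      qed
      ultimately obtain y where y: "\<And>p. y p \<noteq> 0 \<Longrightarrow> p \<in> G \<and> fst p \<subseteq> U"
        "\<And>j. x' j = (\<Sum>p\<in>G. y p * snd p j)"
        using less.hyps[of x'] unfolding J_def by blast
      have "x j = (\<Sum>q\<in>G. (y q + (if q = p then l else 0)) * snd q j)" for j
      proof -
        have "(\<Sum>q\<in>G. (y q + (if q = p then l else 0)) * snd q j) =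
            (\<Sum>q\<in>G. y q * snd q j + (if q = p then l * snd q j else 0))"
          by (intro sum.cong) (auto simp: algebra_simps)
        also have "\<dots> = (\<Sum>q\<in>G. y q * snd q j) + (\<Sum>q\<in>G. if q = p then l * snd q j else 0)"
          by (rule sum.distrib)
        also have "\<dots> = x' j + l * e J j" using pG fin by (simp add: y(2)[symmetric] p_def)
        finally show ?thesis by (simp add: x'_def)
      qed
      moreover have "q \<in> G \<and> fst q \<subseteq> U" if "y q + (if q = p then l else 0) \<noteq> 0" for q
        using that y(1)[of q] pG pU by (auto split: if_splits)
      ultimately show ?thesis
        by (intro exI[of _ "\<lambda>q. y q + (if q = p then l else 0)"]) blast
    qed
  qed
  have sol: "\<forall>p\<in>G. fst p \<subseteq> V \<and> solves c \<beta> C (fst p) (snd p)"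
  proof
    fix p assume "p \<in> G"
    then obtain J where J: "J \<in> Js" "p = (\<Union>j\<in>J. \<beta> j, e J)" by (auto simp: G_def)
    then have Jc: "J \<subseteq> {..<c}" by (simp add: Js_def)
    have "fst p \<subseteq> V" using J Jc \<beta> by fastforce
    moreover have "solves c \<beta> C (fst p) (snd p)"
      using e[OF J(1)] Jc unfolding solves_def S_def J(2) by auto
    ultimately show "fst p \<subseteq> V \<and> solves c \<beta> C (fst p) (snd p)" by blast
  qed
  show ?thesis
    unfolding syzygy_generators_def using fin sol gen by (intro exI[of _ G] conjI allI impI)
qed

text \<open>A generating set of least cardinality satisfies no relation with a unit coefficient.\<close>
lemma minimal_syzygies:
  fixes C :: "nat \<Rightarrow> nat \<Rightarrow> 'a::field"
  assumes \<beta>: "\<And>j. j < c \<Longrightarrow> \<beta> j \<subseteq> V" and tight: "tight c \<beta> C"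
  obtains c' \<beta>' and C' :: "nat \<Rightarrow> nat \<Rightarrow> 'a" where
    "\<And>k. k < c' \<Longrightarrow> \<beta>' k \<subseteq> V" "tight c' \<beta>' C'"
    "\<And>j k. k < c' \<Longrightarrow> C' j k \<noteq> 0 \<Longrightarrow> j < c \<and> \<beta> j \<subset> \<beta>' k"
    "\<And>i k. k < c' \<Longrightarrow> (\<Sum>j<c. C i j * C' j k) = 0"
    "\<And>U x. solves c \<beta> C U x \<Longrightarrow>
      \<exists>y. (\<forall>k. y k \<noteq> 0 \<longrightarrow> k < c' \<and> \<beta>' k \<subseteq> U) \<and> (\<forall>j. x j = (\<Sum>k<c'. C' j k * y k))"
proof -
  obtain G where G: "syzygy_generators c \<beta> C V G"
    and least: "\<And>G'. syzygy_generators c \<beta> C V G' \<Longrightarrow> card G \<le> card G'"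
  proof -
    obtain G0 where "syzygy_generators c \<beta> C V G0" using syzygy_generators_exist[of c \<beta> V C] \<beta> by blast
    from exE[OF ex_has_least_nat[of "syzygy_generators c \<beta> C V", OF this, of card]] that
    show thesis by blast
  qed
  have fin: "finite G" using G by (simp add: syzygy_generators_def)
  obtain h where h: "bij_betw h {..<card G} G"
    using ex_bij_betw_nat_finite[OF fin] by (auto simp: atLeast0LessThan)
  define \<beta>' where "\<beta>' k = fst (h k)" for k
  define C' where "C' j k = snd (h k) j" for j k
  have hG: "h k \<in> G" if "k < card G" for k using h that by (auto simp: bij_betw_def)
  have sol: "solves c \<beta> C (\<beta>' k) (\<lambda>j. C' j k)" "\<beta>' k \<subseteq> V" if "k < card G" for k
    using G hG[OF that] by (auto simp: syzygy_generators_def \<beta>'_def C'_def)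
  have reindex: "(\<Sum>p\<in>G. f p) = (\<Sum>k<card G. f (h k))" for f :: "'b set \<times> (nat \<Rightarrow> 'a) \<Rightarrow> 'a"
    using sum.reindex_bij_betw[OF h, of f] by simp
  have tight': "tight (card G) \<beta>' C'"
    unfolding tight_def
  proof (intro allI impI, rule ccontr)
    fix U y k0
    assume y: "solves (card G) \<beta>' C' U y" and k0: "k0 < card G" "\<beta>' k0 = U" "y k0 \<noteq> 0"
    define Y where "Y p = y (inv_into {..<card G} h p)" for p
    have Yh: "Y (h k) = y k" if "k < card G" for k
      using that h by (simp add: Y_def bij_betw_def inv_into_f_f)
    define p0 where "p0 = h k0"
    have p0: "p0 \<in> G" "fst p0 = U" "Y p0 \<noteq> 0"
      using k0 hG Yh by (auto simp: p0_def \<beta>'_def)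
    have Y0: "(\<Sum>p\<in>G. Y p * snd p j) = 0" for j
      using y Yh by (simp add: reindex solves_def C'_def mult.commute)
    have YU: "fst p \<subseteq> U" if p: "p \<in> G" "Y p \<noteq> 0" for p
    proof -
      obtain k where k: "k < card G" "p = h k" using h p(1) by (auto simp: bij_betw_def)
      then show ?thesis using y p(2) Yh by (auto simp: solves_def \<beta>'_def)
    qed
    have "syzygy_generators c \<beta> C V (G - {p0})"
      unfolding syzygy_generators_def
    proof (intro conjI allI impI)
      show "finite (G - {p0})" using fin by simp
      show "\<forall>p\<in>G - {p0}. fst p \<subseteq> V \<and> solves c \<beta> C (fst p) (snd p)"
        using G by (auto simp: syzygy_generators_def)
      fix U' x assume "solves c \<beta> C U' x"
      then obtain z where z: "\<And>p. z p \<noteq> 0 \<Longrightarrow> p \<in> G \<and> fst p \<subseteq> U'"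
        "\<And>j. x j = (\<Sum>p\<in>G. z p * snd p j)"
        using G unfolding syzygy_generators_def by metis
      \<comment> \<open>Subtracting this multiple of the relation \<open>Y\<close> eliminates
        \<open>p0\<close>. The generators brought in have degree inside that of \<open>p0\<close>,
        hence inside \<open>U'\<close> whenever \<open>z p0\<close> is nonzero.\<close>
      define z' where "z' p = (if p \<in> G then z p - z p0 / Y p0 * Y p else 0)" for p
      have "p \<in> G - {p0} \<and> fst p \<subseteq> U'" if "z' p \<noteq> 0" for p
      proof -
        have p: "p \<in> G" "z p - z p0 / Y p0 * Y p \<noteq> 0" using that by (auto simp: z'_def split: if_splits)
        then have "z p \<noteq> 0 \<or> z p0 \<noteq> 0 \<and> Y p \<noteq> 0" by auto
        then have "fst p \<subseteq> U'" using z(1) YU[OF p(1)] p0 by blast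
        then show ?thesis using p p0 by auto
      qed
      moreover have "x j = (\<Sum>p\<in>G - {p0}. z' p * snd p j)" for j
      proof -
        have "(\<Sum>p\<in>G - {p0}. z' p * snd p j) = (\<Sum>p\<in>G. z' p * snd p j)"
          using fin p0 by (intro sum.mono_neutral_left) (auto simp: z'_def)
        also have "\<dots> = (\<Sum>p\<in>G. z p * snd p j - z p0 / Y p0 * (Y p * snd p j))"
          by (intro sum.cong) (auto simp: z'_def algebra_simps)
        also have "\<dots> = (\<Sum>p\<in>G. z p * snd p j) - z p0 / Y p0 * (\<Sum>p\<in>G. Y p * snd p j)"
          by (simp only: sum_subtractf sum_distrib_left)
        finally show ?thesis using Y0 z(2) by simp
      qed
      ultimately show "\<exists>y. (\<forall>p. y p \<noteq> 0 \<longrightarrow> p \<in> G - {p0} \<and> fst p \<subseteq> U') \<and>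
          (\<forall>j. x j = (\<Sum>p\<in>G - {p0}. y p * snd p j))" by blast
    qed
    from least[OF this] show False
      using fin p0 by (metis card_Diff1_less leD)
  qed
  show ?thesis
  proof (rule that[OF sol(2) tight'])
    fix j k assume k: "k < card G" and "C' j k \<noteq> 0"
    then have "j < c" "\<beta> j \<subseteq> \<beta>' k" using sol(1)[OF k] by (auto simp: solves_def)
    \<comment> \<open>A nonzero coefficient at a basis element of the same degree would contradict
      the tightness of the given matrix.\<close>
    moreover have "\<beta> j \<noteq> \<beta>' k"
      using tight sol(1)[OF k] \<open>C' j k \<noteq> 0\<close> \<open>j < c\<close> unfolding tight_def by metis
    ultimately show "j < c \<and> \<beta> j \<subset> \<beta>' k" by blast
  next
    fix i k assume "k < card G"
    then show "(\<Sum>j<c. C i j * C' j k) = 0" using sol(1) by (simp add: solves_def)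
  next
    fix U x assume "solves c \<beta> C U x"
    then obtain z where z: "\<And>p. z p \<noteq> 0 \<Longrightarrow> p \<in> G \<and> fst p \<subseteq> U"
      "\<And>j. x j = (\<Sum>p\<in>G. z p * snd p j)"
      using G unfolding syzygy_generators_def by metis
    show "\<exists>y. (\<forall>k. y k \<noteq> 0 \<longrightarrow> k < card G \<and> \<beta>' k \<subseteq> U) \<and>
        (\<forall>j. x j = (\<Sum>k<card G. C' j k * y k))"
      using z by (intro exI[of _ "\<lambda>k. if k < card G then z (h k) else 0"])
        (auto simp: reindex C'_def \<beta>'_def mult.commute)
  qed
qed

text \<open>Iterates \<open>minimal_syzygies\<close>, starting from the row of ones. The antichain
  condition makes that row tight, since in degree \<open>E j\<close> only the coordinate j can be
  nonzero; nonemptiness makes the growth of multidegrees strict already from degree 0 to degree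
  1.\<close>

theorem minimal_resolution_exists:
  fixes E :: "nat \<Rightarrow> 'v set"
  assumes V: "finite V" and EV: "\<And>j. j < q \<Longrightarrow> E j \<subseteq> V" and ne: "\<And>j. j < q \<Longrightarrow> E j \<noteq> {}"
    and antichain: "\<And>j l. j < q \<Longrightarrow> l < q \<Longrightarrow> E j \<subseteq> E l \<Longrightarrow> j = l"
  obtains F :: "('v, 'a::field) free_sequence" where
    "free_resolution V (Idl\<^bsub>poly_ring V\<^esub> ((\<lambda>j. sqfree_term (E j)) ` {..<q})) F"
    "multigraded V F" "minimal V F"
proof -
  \<comment> \<open>Rows other than the first are 0, in keeping with \<open>solves\<close>, which
    looks at all row indices.\<close>
  define C1 where "C1 i j = (if i = 0 then 1 else 0 :: 'a)" for i j :: nat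
  define P where "P n s \<longleftrightarrow> (case s of (c, \<beta>, C :: nat \<Rightarrow> nat \<Rightarrow> 'a) \<Rightarrow>
    (n = 0 \<longrightarrow> c = q \<and> \<beta> = E \<and> C = C1) \<and> (\<forall>j<c. \<beta> j \<subseteq> V) \<and> tight c \<beta> C)" for n :: nat and s
  define Q where "Q s s' \<longleftrightarrow> (case s of (c, \<beta>, C :: nat \<Rightarrow> nat \<Rightarrow> 'a) \<Rightarrow> case s' of (c', \<beta>', C') \<Rightarrow>
    (\<forall>j k. k < c' \<longrightarrow> C' j k \<noteq> 0 \<longrightarrow> j < c \<and> \<beta> j \<subset> \<beta>' k) \<and>
    (\<forall>i k. k < c' \<longrightarrow> (\<Sum>j<c. C i j * C' j k) = 0) \<and>
    (\<forall>U x. solves c \<beta> C U x \<longrightarrow>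
      (\<exists>y. (\<forall>k. y k \<noteq> 0 \<longrightarrow> k < c' \<and> \<beta>' k \<subseteq> U) \<and> (\<forall>j. x j = (\<Sum>k<c'. C' j k * y k)))))"
    for s s' :: "nat \<times> (nat \<Rightarrow> 'v set) \<times> (nat \<Rightarrow> nat \<Rightarrow> 'a)"
  have "tight q E C1"
    unfolding tight_def
  proof (intro allI impI)
    fix U x j assume x: "solves q E C1 U x" and j: "j < q" "E j = U"
    have "(\<Sum>l<q. x l) = 0"
      using x by (auto simp: solves_def C1_def dest: spec[of _ 0])
    moreover have "x l = 0" if "l \<noteq> j" for l
      using x j that antichain unfolding solves_def by blast
    then have "(\<Sum>l<q. x l) = (\<Sum>l<q. if l = j then x j else 0)"
      by (intro sum.cong) auto
    ultimately show "x j = 0" using j by simp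
  qed
  then have "P 0 (q, E, C1)" using EV by (simp add: P_def)
  then have start: "\<exists>s. P 0 s" by blast
  have step: "\<exists>s'. P (Suc n) s' \<and> Q s s'" if "P n s" for n s
  proof -
    obtain c \<beta> C where s: "s = (c, \<beta>, C)" by (cases s)
    have *: "\<And>j. j < c \<Longrightarrow> \<beta> j \<subseteq> V" "tight c \<beta> C" using that by (auto simp: P_def s)
    show ?thesis
    proof (rule minimal_syzygies[OF *])
      fix c' \<beta>' and C' :: "nat \<Rightarrow> nat \<Rightarrow> 'a"
      assume "\<And>k. k < c' \<Longrightarrow> \<beta>' k \<subseteq> V" "tight c' \<beta>' C'"
        "\<And>j k. k < c' \<Longrightarrow> C' j k \<noteq> 0 \<Longrightarrow> j < c \<and> \<beta> j \<subset> \<beta>' k"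
        "\<And>i k. k < c' \<Longrightarrow> (\<Sum>j<c. C i j * C' j k) = 0"
        "\<And>U x. solves c \<beta> C U x \<Longrightarrow>
          \<exists>y. (\<forall>k. y k \<noteq> 0 \<longrightarrow> k < c' \<and> \<beta>' k \<subseteq> U) \<and> (\<forall>j. x j = (\<Sum>k<c'. C' j k * y k))"
      then show ?thesis
        by (intro exI[of _ "(c', \<beta>', C')"]) (simp add: P_def Q_def s)
    qed
  qed
  obtain s where s: "\<And>n. P n (s n)" "\<And>n. Q (s n) (s (Suc n))"
    using dependent_nat_choice[of P "\<lambda>_. Q", OF start step] by blast
  \<comment> \<open>State n describes homological degree n + 1; degree 0 is added by hand as one
    basis element of empty multidegree.\<close>
  define r where "r i = (case i of 0 \<Rightarrow> 1 | Suc n \<Rightarrow> fst (s n))" for i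
  define W where "W i = (case i of 0 \<Rightarrow> \<lambda>_. {} | Suc n \<Rightarrow> fst (snd (s n)))" for i
  define C where "C i = snd (snd (s (i - 1)))" for i
  have s_eq: "s n = (r (Suc n), W (Suc n), C (Suc n))" for n
    by (simp add: r_def W_def C_def)
  have s0: "r (Suc 0) = q" "W (Suc 0) = E" "C (Suc 0) = C1"
    using s(1)[of 0] by (simp_all add: P_def s_eq)
  have WV: "j < r i \<Longrightarrow> W i j \<subseteq> V" for i j
    using s(1)[of "i - 1"] s_eq[of "i - 1"]
    by (cases i) (auto simp: P_def W_def[of 0] dest!: spec[of _ j])
  have strict: "j < r i \<and> W i j \<subset> W (Suc i) k" if "k < r (Suc i)" "C (Suc i) j k \<noteq> 0" for i j k
  proof (cases i)
    case 0
    then show ?thesis using that s0 ne by (auto simp: C1_def r_def W_def split: if_splits)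
  next
    case (Suc n)
    then show ?thesis using that s(2)[of n] by (simp add: Q_def s_eq)
  qed
  interpret scalar_resolution V r W C
  proof
    fix i :: nat and U :: "'v set" and x :: "nat \<Rightarrow> 'a"
    assume "\<And>j. x j \<noteq> 0 \<Longrightarrow> j < r (Suc i) \<and> W (Suc i) j \<subseteq> U"
      and *: "\<And>a. a < r i \<Longrightarrow> (\<Sum>j<r (Suc i). C (Suc i) a j * x j) = 0"
    \<comment> \<open>\<open>solves\<close> asks for all rows, and those outside the rank vanish by
      \<open>strict\<close>.\<close>
    moreover have "(\<Sum>j<r (Suc i). C (Suc i) a j * x j) = 0" for a
    proof (cases "a < r i")
      case False
      then have "C (Suc i) a j = 0" if "j < r (Suc i)" for j using strict[OF that] by blast
      then show ?thesis by simp
    qed (rule *)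
    ultimately have "solves (r (Suc i)) (W (Suc i)) (C (Suc i)) U x" by (auto simp: solves_def)
    moreover have "\<forall>U x. solves (r (Suc i)) (W (Suc i)) (C (Suc i)) U x \<longrightarrow>
        (\<exists>y. (\<forall>k. y k \<noteq> 0 \<longrightarrow> k < r (Suc (Suc i)) \<and> W (Suc (Suc i)) k \<subseteq> U) \<and>
        (\<forall>j. x j = (\<Sum>k<r (Suc (Suc i)). C (Suc (Suc i)) j k * y k)))"
      using s(2)[of i] unfolding Q_def s_eq prod.case by (elim conjE)
    ultimately show "\<exists>y. (\<forall>k. y k \<noteq> 0 \<longrightarrow> k < r (Suc (Suc i)) \<and> W (Suc (Suc i)) k \<subseteq> U) \<and>
        (\<forall>j<r (Suc i). x j = (\<Sum>k<r (Suc (Suc i)). C (Suc (Suc i)) j k * y k))"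
      by blast
  next
    fix i a b assume "b < r (Suc (Suc i))"
    then show "(\<Sum>j<r (Suc i). C (Suc i) a j * C (Suc (Suc i)) j b) = 0"
      using s(2)[of i] by (simp add: Q_def s_eq)
  next
    show "W i a \<subseteq> W (Suc i) b" if "b < r (Suc i)" "C (Suc i) a b \<noteq> 0" for i a b
      using strict[OF that] by blast
    show "C 1 0 j = 1" for j by (simp add: s0 C1_def)
    show "r 0 = 1" "W 0 0 = {}" by (simp_all add: r_def W_def)
  qed (rule V, rule WV)
  show ?thesis
  proof (rule that[of sqfree_seq])
    show "free_resolution V (Idl\<^bsub>poly_ring V\<^esub> ((\<lambda>j. sqfree_term (E j)) ` {..<q})) sqfree_seq"
      using free_resolution_sq by (simp add: s0)
    show "minimal V sqfree_seq" using strict by (intro minimal_sq) blast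
  qed (rule multigraded_sq)
qed


section \<open>The Taylor resolution\<close>

definition face_sign :: "nat \<Rightarrow> nat set \<Rightarrow> 'a::field" where
  "face_sign v \<sigma> = (-1) ^ card {w\<in>\<sigma>. w < v}"

text \<open>The incidence number of the simplicial boundary. It is meant for sets differing by one
  element, where \<open>the_elem\<close> is the vertex removed.\<close>

definition taylor_coeff :: "nat set \<Rightarrow> nat set \<Rightarrow> 'a::field" where
  "taylor_coeff \<tau> \<sigma> = (if \<tau> \<subseteq> \<sigma> then face_sign (the_elem (\<sigma> - \<tau>)) \<sigma> else 0)"

lemma face_sign_ne_0 [simp]: "face_sign v \<sigma> \<noteq> (0 :: 'a::field)"
  by (simp add: face_sign_def)

lemma taylor_coeff_insert: "v \<notin> \<tau> \<Longrightarrow> taylor_coeff \<tau> (insert v \<tau>) = face_sign v (insert v \<tau>)"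
proof -
  assume "v \<notin> \<tau>"
  then have "insert v \<tau> - \<tau> = {v}" by blast
  then show ?thesis by (auto simp: taylor_coeff_def)
qed

lemma face_sign_insert_less:
  assumes "finite \<sigma>" "u \<notin> \<sigma>" "u < v"
  shows "face_sign v (insert u \<sigma>) = - (face_sign v \<sigma> :: 'a::field)"
proof -
  have "{w \<in> insert u \<sigma>. w < v} = insert u {w\<in>\<sigma>. w < v}" using assms by auto
  then show ?thesis using assms by (simp add: face_sign_def)
qed

lemma face_sign_insert_ge:
  assumes "\<not> u < v"
  shows "face_sign v (insert u \<sigma>) = face_sign v \<sigma>"
proof -
  have "{w \<in> insert u \<sigma>. w < v} = {w\<in>\<sigma>. w < v}" using assms by auto
  then show ?thesis by (simp add: face_sign_def)
qed

lemma face_sign_least: "(\<And>w. w \<in> \<sigma> \<Longrightarrow> v \<le> w) \<Longrightarrow> face_sign v \<sigma> = 1"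
proof -
  assume "\<And>w. w \<in> \<sigma> \<Longrightarrow> v \<le> w"
  then have "{w\<in>\<sigma>. w < v} = {}" by force
  then show ?thesis by (simp only: face_sign_def card.empty power_0)
qed

text \<open>A superset with one more element arises by inserting a unique new vertex, and all other
  terms vanish. Sums over faces thus become sums over vertices.\<close>

lemma sum_cofaces:
  fixes f :: "nat set \<Rightarrow> 'a::field"
  assumes N: "finite N" and \<tau>: "\<tau> \<in> nsets N i"
  shows "(\<Sum>\<sigma>\<in>nsets N (Suc i). taylor_coeff \<tau> \<sigma> * f \<sigma>) =
    (\<Sum>v\<in>N - \<tau>. face_sign v (insert v \<tau>) * f (insert v \<tau>))"
proof -
  have \<tau>': "\<tau> \<subseteq> N" "finite \<tau>" "card \<tau> = i" using \<tau> by (auto simp: nsets_def)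
  have "(\<Sum>\<sigma>\<in>nsets N (Suc i). taylor_coeff \<tau> \<sigma> * f \<sigma>) =
      (\<Sum>\<sigma>\<in>(\<lambda>v. insert v \<tau>) ` (N - \<tau>). taylor_coeff \<tau> \<sigma> * f \<sigma>)"
  proof (rule sum.mono_neutral_right)
    show "finite (nsets N (Suc i))" using N by (simp add: finite_imp_finite_nsets)
    show "(\<lambda>v. insert v \<tau>) ` (N - \<tau>) \<subseteq> nsets N (Suc i)"
      using \<tau>' by (auto simp: nsets_def)
    show "\<forall>\<sigma>\<in>nsets N (Suc i) - (\<lambda>v. insert v \<tau>) ` (N - \<tau>). taylor_coeff \<tau> \<sigma> * f \<sigma> = 0"
    proof
      fix \<sigma> assume \<sigma>: "\<sigma> \<in> nsets N (Suc i) - (\<lambda>v. insert v \<tau>) ` (N - \<tau>)"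
      have "\<not> \<tau> \<subseteq> \<sigma>"
      proof
        assume sub: "\<tau> \<subseteq> \<sigma>"
        have \<sigma>': "\<sigma> \<subseteq> N" "finite \<sigma>" "card \<sigma> = Suc i" using \<sigma> by (auto simp: nsets_def)
        then have "card (\<sigma> - \<tau>) = 1" using sub \<tau>' by (simp add: card_Diff_subset)
        then obtain v where v: "\<sigma> - \<tau> = {v}" by (auto simp: card_1_singleton_iff)
        then have "\<sigma> = insert v \<tau>" "v \<in> N - \<tau>" using sub \<sigma>' by auto
        then show False using \<sigma> by blast
      qed
      then show "taylor_coeff \<tau> \<sigma> * f \<sigma> = 0" by (simp add: taylor_coeff_def)
    qed
  qed
  also have "\<dots> = (\<Sum>v\<in>N - \<tau>. taylor_coeff \<tau> (insert v \<tau>) * f (insert v \<tau>))"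
    by (subst sum.reindex) (auto simp: inj_on_def)
  also have "\<dots> = (\<Sum>v\<in>N - \<tau>. face_sign v (insert v \<tau>) * f (insert v \<tau>))"
    by (intro sum.cong) (auto simp: taylor_coeff_insert)
  finally show ?thesis .
qed

text \<open>Exactly two sets lie strictly between the given ones. Their contributions cancel because
  the presence of the smaller missing vertex flips the sign of the larger one, but not
  conversely.\<close>

lemma taylor_coeff_comp:
  assumes N: "finite N" and \<tau>: "\<tau> \<in> nsets N i" and \<rho>: "\<rho> \<in> nsets N (Suc (Suc i))"
  shows "(\<Sum>\<sigma>\<in>nsets N (Suc i). taylor_coeff \<tau> \<sigma> * taylor_coeff \<sigma> \<rho>) = (0 :: 'a::field)"
proof (cases "\<tau> \<subseteq> \<rho>")
  case False
  then have "taylor_coeff \<tau> \<sigma> * taylor_coeff \<sigma> \<rho> = (0 :: 'a)" for \<sigma>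
    by (auto simp: taylor_coeff_def)
  then show ?thesis by (simp only: sum.neutral_const)
next
  case True
  have \<tau>': "\<tau> \<subseteq> N" "finite \<tau>" "card \<tau> = i" using \<tau> by (auto simp: nsets_def)
  have \<rho>': "\<rho> \<subseteq> N" "finite \<rho>" "card \<rho> = Suc (Suc i)" using \<rho> by (auto simp: nsets_def)
  have "card (\<rho> - \<tau>) = 2" using True \<tau>' \<rho>' by (simp add: card_Diff_subset)
  then obtain a b where "\<rho> - \<tau> = {a, b}" "a \<noteq> b" by (auto simp: card_2_iff)
  then obtain v w where vw: "\<rho> - \<tau> = {v, w}" "v < w"
    by (metis insert_commute linorder_neqE_nat)
  have mem: "v \<notin> \<tau>" "w \<notin> \<tau>" "v \<in> N" "w \<in> N" "\<rho> = insert v (insert w \<tau>)"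
    using vw True \<rho>' by auto
  have "(\<Sum>\<sigma>\<in>nsets N (Suc i). taylor_coeff \<tau> \<sigma> * taylor_coeff \<sigma> \<rho>) =
      (\<Sum>u\<in>N - \<tau>. face_sign u (insert u \<tau>) * (taylor_coeff (insert u \<tau>) \<rho> :: 'a))"
    by (rule sum_cofaces[OF N \<tau>])
  also have "\<dots> = (\<Sum>u\<in>{v, w}. face_sign u (insert u \<tau>) * taylor_coeff (insert u \<tau>) \<rho>)"
    using N mem vw by (intro sum.mono_neutral_right) (auto simp: taylor_coeff_def)
  also have "\<dots> = face_sign v (insert v \<tau>) * taylor_coeff (insert v \<tau>) \<rho> +
      face_sign w (insert w \<tau>) * taylor_coeff (insert w \<tau>) \<rho>"
    using vw by simp
  also have "taylor_coeff (insert v \<tau>) \<rho> = - (face_sign w (insert w \<tau>) :: 'a)"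
    using taylor_coeff_insert[of w "insert v \<tau>", where 'a = 'a] mem vw \<tau>'
      face_sign_insert_less[of "insert w \<tau>" v w, where 'a = 'a] by (simp add: insert_commute)
  also have "taylor_coeff (insert w \<tau>) \<rho> = (face_sign v (insert v \<tau>) :: 'a)"
    using taylor_coeff_insert[of v "insert w \<tau>", where 'a = 'a] mem vw
      face_sign_insert_ge[of w v "insert v \<tau>", where 'a = 'a] by (simp add: insert_commute)
  finally show ?thesis by simp
qed

text \<open>The cone over the least vertex \<open>u\<close> of \<open>U\<close> is a contracting homotopy of the full simplex on \<open>U\<close>;
  taking the least vertex makes its sign trivial.\<close>
lemma taylor_coeff_exact:
  fixes c :: "nat set \<Rightarrow> 'a::field"
  assumes N: "finite N" and UN: "U \<subseteq> N"
    and c: "\<And>\<sigma>. c \<sigma> \<noteq> 0 \<Longrightarrow> \<sigma> \<in> nsets U (Suc i)"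
    and ker: "\<And>\<tau>. \<tau> \<in> nsets N i \<Longrightarrow> (\<Sum>\<sigma>\<in>nsets N (Suc i). taylor_coeff \<tau> \<sigma> * c \<sigma>) = 0"
  obtains e where "\<And>\<rho>. e \<rho> \<noteq> 0 \<Longrightarrow> \<rho> \<in> nsets U (Suc (Suc i))"
    "\<And>\<sigma>. \<sigma> \<in> nsets N (Suc i) \<Longrightarrow> c \<sigma> = (\<Sum>\<rho>\<in>nsets N (Suc (Suc i)). taylor_coeff \<sigma> \<rho> * e \<rho>)"
proof (cases "U = {}")
  case True
  then have "c \<sigma> = 0" for \<sigma> using c[of \<sigma>] by (force simp: nsets_def)
  then show ?thesis using that[of "\<lambda>_. 0"] by simp
next
  case False
  have finU: "finite U" using N UN finite_subset by blast
  define u where "u = Min U"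
  have u: "u \<in> U" "\<And>w. w \<in> U \<Longrightarrow> u \<le> w" using False finU by (auto simp: u_def)
  define e where "e \<rho> = (if u \<in> \<rho> \<and> \<rho> \<in> nsets U (Suc (Suc i)) then c (\<rho> - {u}) else 0)" for \<rho>
  have "c \<sigma> = (\<Sum>\<rho>\<in>nsets N (Suc (Suc i)). taylor_coeff \<sigma> \<rho> * e \<rho>)" if \<sigma>: "\<sigma> \<in> nsets N (Suc i)" for \<sigma>
  proof -
    have \<sigma>': "\<sigma> \<subseteq> N" "finite \<sigma>" "card \<sigma> = Suc i" using \<sigma> by (auto simp: nsets_def)
    have S: "(\<Sum>\<rho>\<in>nsets N (Suc (Suc i)). taylor_coeff \<sigma> \<rho> * e \<rho>) =
        (\<Sum>v\<in>N - \<sigma>. face_sign v (insert v \<sigma>) * e (insert v \<sigma>))"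
      by (rule sum_cofaces[OF N \<sigma>])
    consider "\<not> \<sigma> \<subseteq> U" | "\<sigma> \<subseteq> U" "u \<notin> \<sigma>" | "\<sigma> \<subseteq> U" "u \<in> \<sigma>" by blast
    then show ?thesis
    proof cases
      case 1
      then have "c \<sigma> = 0" using c[of \<sigma>] by (auto simp: nsets_def)
      moreover have "e (insert v \<sigma>) = 0" for v using 1 by (auto simp: e_def nsets_def)
      ultimately show ?thesis using S by simp
    next
      case 2
      \<comment> \<open>\<open>e\<close> is supported on sets through \<open>u\<close>, so only the
        insertion of \<open>u\<close> contributes.\<close>
      have "(\<Sum>v\<in>N - \<sigma>. face_sign v (insert v \<sigma>) * e (insert v \<sigma>)) =
          (\<Sum>v\<in>{u}. face_sign v (insert v \<sigma>) * e (insert v \<sigma>))"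
        using N 2 u UN by (intro sum.mono_neutral_right) (auto simp: e_def)
      also have "\<dots> = c \<sigma>"
        using 2 u \<sigma>' face_sign_least[of "insert u \<sigma>" u] by (auto simp: e_def nsets_def)
      finally show ?thesis using S by simp
    next
      case 3
      \<comment> \<open>In the kernel equation at \<open>\<tau>\<close> the term of \<open>u\<close>
        is the value of \<open>c\<close> at \<open>\<sigma>\<close>; the remaining terms are, up to
        sign, the values of the cone at the cofaces of \<open>\<sigma>\<close>.\<close>
      define \<tau> where "\<tau> = \<sigma> - {u}"
      have \<tau>: "u \<notin> \<tau>" "\<sigma> = insert u \<tau>" "finite \<tau>" "\<tau> \<in> nsets N i"
        using 3 \<sigma>' by (auto simp: \<tau>_def nsets_def)
      have N\<tau>: "N - \<tau> = insert u (N - \<sigma>)" "u \<notin> N - \<sigma>" using \<tau> u UN by auto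
      have "0 = (\<Sum>v\<in>N - \<tau>. face_sign v (insert v \<tau>) * c (insert v \<tau>))"
        using ker[OF \<tau>(4)] sum_cofaces[OF N \<tau>(4), of c] by simp
      also have "\<dots> = c \<sigma> + (\<Sum>v\<in>N - \<sigma>. face_sign v (insert v \<tau>) * c (insert v \<tau>))"
      proof -
        have "face_sign u \<sigma> = (1 :: 'a)" using 3 u by (intro face_sign_least) blast
        then show ?thesis unfolding N\<tau>(1) using N N\<tau>(2) by (simp add: \<tau>(2)[symmetric])
      qed
      also have "(\<Sum>v\<in>N - \<sigma>. face_sign v (insert v \<tau>) * c (insert v \<tau>)) =
          (\<Sum>v\<in>N - \<sigma>. - (face_sign v (insert v \<sigma>) * e (insert v \<sigma>)))"
      proof (intro sum.cong refl)
        fix v assume v: "v \<in> N - \<sigma>"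
        show "face_sign v (insert v \<tau>) * c (insert v \<tau>) =
          - (face_sign v (insert v \<sigma>) * e (insert v \<sigma>))"
        proof (cases "v \<in> U")
          case True
          have vu: "v \<noteq> u" using v \<tau> by auto
          then have "u < v" using u(2)[OF True] by simp
          then have "face_sign v (insert v \<sigma>) = - (face_sign v (insert v \<tau>) :: 'a)"
            using face_sign_insert_less[of "insert v \<tau>" u v] \<tau> by (simp add: insert_commute)
          moreover have "e (insert v \<sigma>) = c (insert v \<tau>)"
          proof -
            have "insert v \<sigma> - {u} = insert v \<tau>" using vu by (auto simp: \<tau>_def)
            moreover have "insert v \<sigma> \<in> nsets U (Suc (Suc i))"
              using True 3 \<sigma>' v by (simp add: nsets_def)
            ultimately show ?thesis using 3 by (simp add: e_def)
          qed
          ultimately show ?thesis by simp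
        next
          case False
          then have "c (insert v \<tau>) = 0" using c[of "insert v \<tau>"] by (auto simp: nsets_def)
          moreover have "e (insert v \<sigma>) = 0" using False by (auto simp: e_def nsets_def)
          ultimately show ?thesis by simp
        qed
      qed
      finally show ?thesis using S by (simp add: sum_negf)
    qed
  qed
  moreover have "\<rho> \<in> nsets U (Suc (Suc i))" if "e \<rho> \<noteq> 0" for \<rho>
    using that by (simp add: e_def split: if_splits)
  ultimately show ?thesis using that[of e] by blast
qed

lemma card_nsets: "finite A \<Longrightarrow> card (nsets A i) = card A choose i"
  using n_subsets[of A i] by (simp add: nsets_def finite_subset conj_commute cong: conj_cong)

text \<open>Basis elements in degree i are the i-sets of generators, with the union of the
  \<open>E v\<close> as multidegree. In degree \<open>U\<close> this is the augmented chain complex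
  of the full simplex on the v with \<open>E v\<close> inside \<open>U\<close>. A differential is
  minimal iff removing a vertex always changes the union.\<close>

theorem taylor_resolution:
  fixes E :: "nat \<Rightarrow> 'v set"
  assumes V: "finite V" and EV: "\<And>j. j < q \<Longrightarrow> E j \<subseteq> V"
  obtains T :: "('v, 'a::field) free_sequence" where
    "free_resolution V (Idl\<^bsub>poly_ring V\<^esub> ((\<lambda>j. sqfree_term (E j)) ` {..<q})) T"
    "\<And>i. rk T i = q choose i"
    "\<And>i. const_mat (dif T (Suc i)) = 0\<^sub>m (rk T i) (rk T (Suc i)) \<longleftrightarrow>
      (\<forall>\<sigma>\<in>nsets {..<q} (Suc i). \<forall>v\<in>\<sigma>. \<not> E v \<subseteq> (\<Union>w\<in>\<sigma> - {v}. E w))"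
proof -
  define en where "en i = (SOME h. bij_betw h {..<q choose i} (nsets {..<q} i))" for i
  have en: "bij_betw (en i) {..<q choose i} (nsets {..<q} i)" for i
  proof -
    have "finite (nsets {..<q} i)" by (simp add: finite_imp_finite_nsets)
    from ex_bij_betw_nat_finite[OF this]
    have "\<exists>h. bij_betw h {..<q choose i} (nsets {..<q} i)"
      by (simp only: card_nsets finite_lessThan card_lessThan atLeast0LessThan)
    from someI_ex[OF this] show ?thesis unfolding en_def .
  qed
  have en_in: "en i a \<in> nsets {..<q} i" if "a < q choose i" for i a
    using en[of i] that by (auto simp: bij_betw_def)
  have en_ex: "\<exists>a<q choose i. \<sigma> = en i a" if "\<sigma> \<in> nsets {..<q} i" for i \<sigma>
    using en[of i] that by (auto simp: bij_betw_def)
  have reindex: "(\<Sum>a<q choose i. f (en i a)) = (\<Sum>\<sigma>\<in>nsets {..<q} i. f \<sigma>)"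
    for i and f :: "nat set \<Rightarrow> 'a"
    by (rule sum.reindex_bij_betw[OF en])
  define L where "L \<sigma> = (\<Union>v\<in>\<sigma>. E v)" for \<sigma>
  define W where "W i a = L (en i a)" for i a
  define C where "C i a b = (taylor_coeff (en (i - 1) a) (en i b) :: 'a)" for i a b
  interpret scalar_resolution V "\<lambda>i. q choose i" W C
  proof
    show "W 0 0 = {}" using en_in[of 0 0] by (simp add: W_def L_def)
    show "W i j \<subseteq> V" if "j < q choose i" for i j
      using en_in[OF that] EV by (fastforce simp: W_def L_def nsets_def)
    show "W i a \<subseteq> W (Suc i) b" if "C (Suc i) a b \<noteq> 0" for i a b
      using that by (auto simp: W_def L_def C_def taylor_coeff_def split: if_splits)
    show "C 1 0 j = 1" if j: "j < q choose 1" for j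
    proof -
      have "en 0 0 = {}" using en_in[of 0 0] by simp
      moreover obtain v where "en 1 j = {v}"
        using en_in[OF j] by (auto simp: nsets_def card_1_singleton_iff)
      moreover have "face_sign v {v} = (1 :: 'a)" by (rule face_sign_least) simp
      ultimately show ?thesis
        by (simp add: C_def taylor_coeff_insert face_sign_least)
    qed
    show "(\<Sum>j<q choose Suc i. C (Suc i) a j * C (Suc (Suc i)) j b) = 0"
      if "a < q choose i" "b < q choose Suc (Suc i)" for i a b
      using reindex[of "\<lambda>\<sigma>. taylor_coeff (en i a) \<sigma> * taylor_coeff \<sigma> (en (Suc (Suc i)) b)" "Suc i"]
        taylor_coeff_comp[OF finite_lessThan en_in en_in, OF that] by (simp add: C_def)
    fix i :: nat and U :: "'v set" and x :: "nat \<Rightarrow> 'a"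
    assume x: "\<And>j. x j \<noteq> 0 \<Longrightarrow> j < q choose Suc i \<and> W (Suc i) j \<subseteq> U"
      and ker: "\<And>a. a < q choose i \<Longrightarrow> (\<Sum>j<q choose Suc i. C (Suc i) a j * x j) = 0"
    \<comment> \<open>The vertices of the simplex that the degree \<open>U\<close> sees.\<close>
    define A where "A = {v. v < q \<and> E v \<subseteq> U}"
    define c where "c \<sigma> = (if \<sigma> \<in> nsets {..<q} (Suc i)
      then x (inv_into {..<q choose Suc i} (en (Suc i)) \<sigma>) else 0)" for \<sigma>
    have c_en: "c (en (Suc i) j) = x j" if "j < q choose Suc i" for j
      using that en_in[OF that] en[of "Suc i"] by (simp add: c_def bij_betw_def inv_into_f_f)
    have A_iff: "\<sigma> \<in> nsets A m \<longleftrightarrow> \<sigma> \<in> nsets {..<q} m \<and> L \<sigma> \<subseteq> U" for \<sigma> m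
      by (auto simp: nsets_def A_def L_def)
    obtain e where e: "\<And>\<rho>. e \<rho> \<noteq> 0 \<Longrightarrow> \<rho> \<in> nsets A (Suc (Suc i))"
      "\<And>\<sigma>. \<sigma> \<in> nsets {..<q} (Suc i) \<Longrightarrow>
        c \<sigma> = (\<Sum>\<rho>\<in>nsets {..<q} (Suc (Suc i)). taylor_coeff \<sigma> \<rho> * e \<rho>)"
    proof (rule taylor_coeff_exact[of "{..<q}" A c i])
      show "A \<subseteq> {..<q}" by (auto simp: A_def)
      show "\<sigma> \<in> nsets A (Suc i)" if "c \<sigma> \<noteq> 0" for \<sigma>
      proof -
        have \<sigma>: "\<sigma> \<in> nsets {..<q} (Suc i)" using that by (auto simp: c_def split: if_splits)
        then obtain j where "j < q choose Suc i" "\<sigma> = en (Suc i) j" using en_ex by blast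
        then show ?thesis using that c_en x \<sigma> by (auto simp: A_iff W_def)
      qed
      show "(\<Sum>\<sigma>\<in>nsets {..<q} (Suc i). taylor_coeff \<tau> \<sigma> * c \<sigma>) = 0"
        if \<tau>: "\<tau> \<in> nsets {..<q} i" for \<tau>
      proof -
        obtain a where a: "a < q choose i" "\<tau> = en i a" using \<tau> en_ex by blast
        show ?thesis
          using ker[OF a(1)] reindex[of "\<lambda>\<sigma>. taylor_coeff \<tau> \<sigma> * c \<sigma>" "Suc i"]
          by (simp add: c_en C_def a(2))
      qed
    qed auto
    show "\<exists>y. (\<forall>k. y k \<noteq> 0 \<longrightarrow> k < q choose Suc (Suc i) \<and> W (Suc (Suc i)) k \<subseteq> U) \<and>
        (\<forall>j<q choose Suc i. x j = (\<Sum>k<q choose Suc (Suc i). C (Suc (Suc i)) j k * y k))"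
    proof (intro exI[of _ "\<lambda>k. if k < q choose Suc (Suc i) then e (en (Suc (Suc i)) k) else 0"]
        conjI allI impI)
      fix j assume j: "j < q choose Suc i"
      have "x j = (\<Sum>\<rho>\<in>nsets {..<q} (Suc (Suc i)). taylor_coeff (en (Suc i) j) \<rho> * e \<rho>)"
        using e(2)[OF en_in[OF j]] c_en[OF j] by simp
      also have "\<dots> = (\<Sum>k<q choose Suc (Suc i). C (Suc (Suc i)) j k * e (en (Suc (Suc i)) k))"
        unfolding reindex[symmetric] by (simp add: C_def)
      finally show "x j = (\<Sum>k<q choose Suc (Suc i). C (Suc (Suc i)) j k *
          (if k < q choose Suc (Suc i) then e (en (Suc (Suc i)) k) else 0))" by simp
    qed (use e(1) A_iff in \<open>auto simp: W_def split: if_splits\<close>)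
  qed (use V in auto)
  have img: "(\<lambda>j. sqfree_term (W 1 j)) ` {..<q choose 1} =
      ((\<lambda>j. sqfree_term (E j)) ` {..<q} :: ('v, 'a) mpoly set)"
  proof -
    have "W 1 ` {..<q choose 1} = L ` (en 1 ` {..<q choose 1})" by (auto simp: W_def)
    also have "en 1 ` {..<q choose 1} = nsets {..<q} 1" using en[of 1] by (simp add: bij_betw_def)
    also have "nsets {..<q} 1 = (\<lambda>v. {v}) ` {..<q}"
      by (auto simp: nsets_def card_1_singleton_iff)
    also have "L ` \<dots> = E ` {..<q}" by (auto simp: L_def)
    finally have "sqfree_term ` W 1 ` {..<q choose 1} = (sqfree_term ` E ` {..<q} :: ('v, 'a) mpoly set)"
      by simp
    then show ?thesis by (simp only: image_image)
  qed
  show ?thesis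
  proof (rule that[of sqfree_seq])
    show "free_resolution V (Idl\<^bsub>poly_ring V\<^esub> ((\<lambda>j. sqfree_term (E j)) ` {..<q})) sqfree_seq"
      using free_resolution_sq unfolding img .
    fix i
    have "const_mat (dif sqfree_seq (Suc i)) = 0\<^sub>m (rk sqfree_seq i) (rk sqfree_seq (Suc i)) \<longleftrightarrow>
      (\<forall>\<tau>\<in>nsets {..<q} i. \<forall>\<sigma>\<in>nsets {..<q} (Suc i). \<tau> \<subseteq> \<sigma> \<longrightarrow> L \<tau> \<noteq> L \<sigma>)"
      (is "?M \<longleftrightarrow> ?N")
    proof -
      have "?M \<longleftrightarrow> (\<forall>a<q choose i. \<forall>b<q choose Suc i.
          en i a \<subseteq> en (Suc i) b \<longrightarrow> L (en i a) \<noteq> L (en (Suc i) b))"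
        unfolding rk_sq const_mat_dif_sq by (auto simp: C_def W_def taylor_coeff_def)
      also have "\<dots> \<longleftrightarrow> ?N" using en_in en_ex by metis
      finally show ?thesis .
    qed
    also have "?N \<longleftrightarrow> (\<forall>\<sigma>\<in>nsets {..<q} (Suc i). \<forall>v\<in>\<sigma>. \<not> E v \<subseteq> (\<Union>w\<in>\<sigma> - {v}. E w))"
    proof (intro iffI ballI impI)
      fix \<sigma> v assume N: ?N and \<sigma>: "\<sigma> \<in> nsets {..<q} (Suc i)" and v: "v \<in> \<sigma>"
      have "\<sigma> - {v} \<in> nsets {..<q} i" using \<sigma> v by (auto simp: nsets_def)
      then have "L (\<sigma> - {v}) \<noteq> L \<sigma>" using N \<sigma> by blast
      moreover have "L \<sigma> = E v \<union> L (\<sigma> - {v})" using v by (auto simp: L_def)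
      ultimately show "\<not> E v \<subseteq> (\<Union>w\<in>\<sigma> - {v}. E w)" unfolding L_def by blast
    next
      fix \<tau> \<sigma> assume R: "\<forall>\<sigma>\<in>nsets {..<q} (Suc i). \<forall>v\<in>\<sigma>. \<not> E v \<subseteq> (\<Union>w\<in>\<sigma> - {v}. E w)"
        and \<tau>: "\<tau> \<in> nsets {..<q} i" and \<sigma>: "\<sigma> \<in> nsets {..<q} (Suc i)" and sub: "\<tau> \<subseteq> \<sigma>"
      have "card (\<sigma> - \<tau>) = 1" using \<tau> \<sigma> sub by (auto simp: nsets_def card_Diff_subset)
      then obtain v where v: "\<sigma> - \<tau> = {v}" by (auto simp: card_1_singleton_iff)
      then have "\<tau> = \<sigma> - {v}" "v \<in> \<sigma>" using sub by auto
      then have "\<not> E v \<subseteq> L \<tau>" using R \<sigma> by (simp add: L_def)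
      moreover have "E v \<subseteq> L \<sigma>" using \<open>v \<in> \<sigma>\<close> by (auto simp: L_def)
      ultimately show "L \<tau> \<noteq> L \<sigma>" by blast
    qed
    finally show "const_mat (dif sqfree_seq (Suc i)) = 0\<^sub>m (rk sqfree_seq i) (rk sqfree_seq (Suc i)) \<longleftrightarrow>
      (\<forall>\<sigma>\<in>nsets {..<q} (Suc i). \<forall>v\<in>\<sigma>. \<not> E v \<subseteq> (\<Union>w\<in>\<sigma> - {v}. E w))" .
  qed simp
qed


section \<open>Betti numbers of shadow ideals\<close>

definition irredundant :: "(nat \<Rightarrow> 'v set) \<Rightarrow> nat \<Rightarrow> nat \<Rightarrow> bool" where
  "irredundant E q i \<longleftrightarrow> (\<forall>\<sigma>\<in>nsets {..<q} i. \<forall>v\<in>\<sigma>. \<not> E v \<subseteq> (\<Union>w\<in>\<sigma> - {v}. E w))"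

context
  fixes V :: "'v set" and E :: "nat \<Rightarrow> 'v set" and q :: nat
  assumes V: "finite V" and EV: "\<And>j. j < q \<Longrightarrow> E j \<subseteq> V" and ne: "\<And>j. j < q \<Longrightarrow> E j \<noteq> {}"
    and antichain: "\<And>j l. j < q \<Longrightarrow> l < q \<Longrightarrow> E j \<subseteq> E l \<Longrightarrow> j = l"
begin

text \<open>\<open>comparison\<close> is used in both directions. With the minimal resolution as
  source, its ranks are at most the Taylor ranks, and equality in degree i + 1 makes the Taylor
  differential out of degree i + 2 into it minimal. With the Taylor resolution as source, minimality
  on both sides of degree i + 1 gives the reverse inequality.\<close>

lemma betti_squarefree:
  fixes M :: "('v, 'a::field) mpoly set"
  assumes M: "M = Idl\<^bsub>poly_ring V\<^esub> ((\<lambda>j. sqfree_term (E j)) ` {..<q})"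
  shows betti_squarefree_0: "betti V M 0 = 1"
    and betti_squarefree_eq: "irredundant E q (Suc i) \<Longrightarrow> irredundant E q (Suc (Suc i)) \<Longrightarrow>
      betti V M (Suc i) = q choose Suc i"
    and betti_squarefree_irredundant: "betti V M (Suc i) = q choose Suc i \<Longrightarrow>
      irredundant E q (Suc (Suc i))"
proof -
  obtain F :: "('v, 'a) free_sequence" where F: "free_resolution V M F" "multigraded V F" "minimal V F"
    unfolding M by (rule minimal_resolution_exists[of V q E, OF V EV ne antichain])
  obtain T :: "('v, 'a) free_sequence" where T: "free_resolution V M T" "\<And>i. rk T i = q choose i"
    "\<And>i. const_mat (dif T (Suc i)) = 0\<^sub>m (rk T i) (rk T (Suc i)) \<longleftrightarrow> irredundant E q (Suc i)"
  proof (rule taylor_resolution[of V q E, OF V EV])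
    fix T :: "('v, 'a) free_sequence"
    assume T: "free_resolution V (Idl\<^bsub>poly_ring V\<^esub> ((\<lambda>j. sqfree_term (E j)) ` {..<q})) T"
      "\<And>i. rk T i = q choose i"
      "\<And>i. const_mat (dif T (Suc i)) = 0\<^sub>m (rk T i) (rk T (Suc i)) \<longleftrightarrow>
        (\<forall>\<sigma>\<in>nsets {..<q} (Suc i). \<forall>v\<in>\<sigma>. \<not> E v \<subseteq> (\<Union>w\<in>\<sigma> - {v}. E w))"
    show thesis by (rule that[of T, unfolded M irredundant_def]) (fact T)+
  qed
  note b = betti_eq_rk[OF F]
  note minF = minimal_const_mat[OF F(1,3)]
  show "betti V M 0 = 1" using resolution_rk_0[OF F(1)] b by simp
  show "betti V M (Suc i) = q choose Suc i"
    if "irredundant E q (Suc i)" "irredundant E q (Suc (Suc i))"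
    using rk_le_of_minimal[OF F(1) T(1) minF minF] that
      rk_le_of_minimal[OF T(1) F(1), of i] T(2,3) b by (intro antisym) auto
  show "irredundant E q (Suc (Suc i))" if "betti V M (Suc i) = q choose Suc i"
    using minimal_of_rk_eq[OF F(1) T(1) minF minF, of i] that T(2,3) b by auto
qed

end

text \<open>The index counts only the covering blocks, whereas that of \<open>irredundant\<close>
  also counts the covered one; this is the shift by \<open>Suc\<close> between the two.\<close>

definition uncovered :: "nat \<Rightarrow> nat set set \<Rightarrow> nat \<Rightarrow> bool" where
  "uncovered s B i \<longleftrightarrow> (\<forall>b\<in>B. \<forall>S. S \<subseteq> B - {b} \<longrightarrow> card S = i \<longrightarrow>
     \<not> nsets b s \<subseteq> (\<Union>c\<in>S. nsets c s))"

lemma prod_Var: "finite U \<Longrightarrow> (\<Prod>A\<in>U. Var A) = (sqfree_term U :: ('v, 'a::field) mpoly)"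
  by (induction U rule: finite_induct) (simp_all add: Var_def sqfree_monomial_def mult_single)

text \<open>Every point of \<open>b\<close> lies in some s-subset of \<open>b\<close>, because
  \<open>b\<close> has at least s points.\<close>

lemma nsets_subset_imp_subset:
  assumes "finite b" "1 \<le> s" "s \<le> card b" "nsets b s \<subseteq> nsets c s"
  shows "b \<subseteq> c"
proof
  fix x assume x: "x \<in> b"
  have "s - 1 \<le> card (b - {x})" using assms x by simp
  then obtain S where S: "S \<subseteq> b - {x}" "card S = s - 1" "finite S"
    by (rule obtain_subset_with_card_n)
  then have "insert x S \<in> nsets b s" using x assms by (auto simp: nsets_def card_insert_if)
  then have "insert x S \<in> nsets c s" using assms(4) by blast
  then show "x \<in> c" by (simp add: nsets_def)
qed

context
  fixes s k n :: nat and B :: "nat set set"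
  assumes s: "1 \<le> s" "s \<le> k" and B: "B \<subseteq> nsets {1..n} k"
begin

lemma shadow_antichain:
  assumes "b \<in> B" "c \<in> B" "nsets b s \<subseteq> nsets c s"
  shows "b = c"
proof -
  have bc: "finite b" "card b = k" "finite c" "card c = k" using assms B by (auto simp: nsets_def)
  have "b \<subseteq> c" using nsets_subset_imp_subset[OF bc(1) s(1) _ assms(3)] s bc by simp
  then show ?thesis using card_subset_eq[OF bc(3)] bc by simp
qed

lemma shadow_nonempty:
  assumes "b \<in> B"
  shows "nsets b s \<noteq> {}"
proof -
  have "finite b" "card b = k" using assms B by (auto simp: nsets_def)
  then have "0 < card (nsets b s)" using s by (simp add: card_nsets)
  then show ?thesis by (metis card.empty less_irrefl)
qed

text \<open>The two cases that hold for any collection of blocks: shadows are nonempty and form an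
  antichain. They yield that the first Betti number is \<open>card B\<close>.\<close>

lemma uncovered_small: "uncovered s B 0" "uncovered s B 1"
proof -
  have "finite S" if "S \<subseteq> B - {b}" for S b
    using that B finite_subset finite_imp_finite_nsets[of "{1..n}" k] by (metis Diff_subset finite_atLeastAtMost)
  then show "uncovered s B 0"
    using shadow_nonempty by (auto simp: uncovered_def)
  show "uncovered s B 1"
    using shadow_antichain by (auto simp: uncovered_def card_1_singleton_iff)
qed

lemma shadow_enumeration:
  obtains h where "bij_betw h {..<card B} B" "finite (nsets {1..n} s)"
    "\<And>j. j < card B \<Longrightarrow> nsets (h j) s \<subseteq> nsets {1..n} s"
    "\<And>j. j < card B \<Longrightarrow> nsets (h j) s \<noteq> {}"
    "\<And>j l. j < card B \<Longrightarrow> l < card B \<Longrightarrow> nsets (h j) s \<subseteq> nsets (h l) s \<Longrightarrow> j = l"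
    "(shadow_ideal s n B :: (nat set, 'a::field) mpoly set) =
      Idl\<^bsub>poly_ring (nsets {1..n} s)\<^esub> ((\<lambda>j. sqfree_term (nsets (h j) s)) ` {..<card B})"
    "\<And>i. irredundant (\<lambda>j. nsets (h j) s) (card B) (Suc i) \<longleftrightarrow> uncovered s B i"
proof -
  have finB: "finite B" using B finite_subset finite_imp_finite_nsets[of "{1..n}" k] by blast
  obtain h where h: "bij_betw h {..<card B} B"
    using ex_bij_betw_nat_finite[OF finB] by (auto simp: atLeast0LessThan)
  have hB: "h ` {..<card B} = B" and inj: "inj_on h {..<card B}" using h by (auto simp: bij_betw_def)
  have hj: "h j \<in> B" if "j < card B" for j using hB that by blast
  have fin: "finite b" "b \<subseteq> {1..n}" if "b \<in> B" for b using that B by (auto simp: nsets_def)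
  have "(\<lambda>b. \<Prod>A\<in>nsets b s. Var A) ` B =
      ((\<lambda>j. sqfree_term (nsets (h j) s)) ` {..<card B} :: (nat set, 'a) mpoly set)"
  proof -
    have "(\<lambda>b. \<Prod>A\<in>nsets b s. Var A) ` B =
        ((\<lambda>b. sqfree_term (nsets b s)) ` B :: (nat set, 'a) mpoly set)"
      using fin by (intro image_cong prod_Var) (auto simp: finite_imp_finite_nsets)
    also have "\<dots> = (\<lambda>b. sqfree_term (nsets b s)) ` (h ` {..<card B})" by (simp only: hB)
    finally show ?thesis by (simp only: image_image)
  qed
  then have ideal: "(shadow_ideal s n B :: (nat set, 'a) mpoly set) =
      Idl\<^bsub>poly_ring (nsets {1..n} s)\<^esub> ((\<lambda>j. sqfree_term (nsets (h j) s)) ` {..<card B})"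
    by (simp add: shadow_ideal_def)
  have irr: "irredundant (\<lambda>j. nsets (h j) s) (card B) (Suc i) \<longleftrightarrow> uncovered s B i" for i
  proof
    assume L: "irredundant (\<lambda>j. nsets (h j) s) (card B) (Suc i)"
    show "uncovered s B i"
      unfolding uncovered_def
    proof (intro ballI allI impI notI)
      fix b S assume b: "b \<in> B" and S: "S \<subseteq> B - {b}" "card S = i"
        and cov: "nsets b s \<subseteq> (\<Union>c\<in>S. nsets c s)"
      obtain v where v: "v < card B" "b = h v" using b hB by blast
      obtain R where R: "R \<subseteq> {..<card B}" "S = h ` R"
        using S hB by (metis Diff_subset subset_imageE subset_trans)
      have "v \<notin> R" using S R v by blast
      have "card R = i" using S R inj card_image inj_on_subset by metis
      then have "insert v R \<in> nsets {..<card B} (Suc i)"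
        using R v \<open>v \<notin> R\<close> finite_subset[OF R(1)] by (auto simp: nsets_def)
      then have "\<not> nsets (h v) s \<subseteq> (\<Union>w\<in>insert v R - {v}. nsets (h w) s)"
        using L unfolding irredundant_def by blast
      moreover have "insert v R - {v} = R" using \<open>v \<notin> R\<close> by blast
      ultimately show False using cov v R by simp
    qed
  next
    assume U: "uncovered s B i"
    show "irredundant (\<lambda>j. nsets (h j) s) (card B) (Suc i)"
      unfolding irredundant_def
    proof (intro ballI notI)
      fix \<sigma> v assume \<sigma>: "\<sigma> \<in> nsets {..<card B} (Suc i)" and v: "v \<in> \<sigma>"
        and cov: "nsets (h v) s \<subseteq> (\<Union>w\<in>\<sigma> - {v}. nsets (h w) s)"
      have \<sigma>': "\<sigma> \<subseteq> {..<card B}" "finite \<sigma>" "card \<sigma> = Suc i" using \<sigma> by (auto simp: nsets_def)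
      have "card (h ` (\<sigma> - {v})) = i"
        using \<sigma>' v inj by (subst card_image) (auto intro: inj_on_subset)
      moreover have "h ` (\<sigma> - {v}) \<subseteq> B - {h v}"
        using \<sigma>' v inj hj by (auto dest: inj_onD)
      moreover have "h v \<in> B" using hj \<sigma>' v by blast
      ultimately have "\<not> nsets (h v) s \<subseteq> (\<Union>c\<in>h ` (\<sigma> - {v}). nsets c s)"
        using U unfolding uncovered_def by blast
      then show False using cov by simp
    qed
  qed
  show ?thesis
  proof (rule that[OF h _ _ _ _ ideal irr])
    show "finite (nsets {1..n} s)" by (simp add: finite_imp_finite_nsets)
    show "nsets (h j) s \<subseteq> nsets {1..n} s" if "j < card B" for j
      using fin(2)[OF hj[OF that]] by (auto simp: nsets_def)
    show "nsets (h j) s \<noteq> {}" if "j < card B" for j using shadow_nonempty[OF hj[OF that]] .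
    show "j = l" if "j < card B" "l < card B" "nsets (h j) s \<subseteq> nsets (h l) s" for j l
      using shadow_antichain[OF hj[OF that(1)] hj[OF that(2)] that(3)] inj that by (auto dest: inj_onD)
  qed
qed

lemma betti_shadow_ideal:
  fixes M :: "(nat set, 'a::field) mpoly set"
  assumes M: "M = shadow_ideal s n B"
  shows betti_shadow_ideal_eq:
      "(\<And>j. j \<le> i \<Longrightarrow> uncovered s B j) \<Longrightarrow> betti (nsets {1..n} s) M i = card B choose i"
    and betti_shadow_ideal_uncovered:
      "1 \<le> i \<Longrightarrow> betti (nsets {1..n} s) M i = card B choose i \<Longrightarrow> uncovered s B i"
proof -
  obtain h where h: "bij_betw h {..<card B} B" "finite (nsets {1..n} s)"
    "\<And>j. j < card B \<Longrightarrow> nsets (h j) s \<subseteq> nsets {1..n} s"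
    "\<And>j. j < card B \<Longrightarrow> nsets (h j) s \<noteq> {}"
    "\<And>j l. j < card B \<Longrightarrow> l < card B \<Longrightarrow> nsets (h j) s \<subseteq> nsets (h l) s \<Longrightarrow> j = l"
    "M = Idl\<^bsub>poly_ring (nsets {1..n} s)\<^esub> ((\<lambda>j. sqfree_term (nsets (h j) s)) ` {..<card B})"
    "\<And>i. irredundant (\<lambda>j. nsets (h j) s) (card B) (Suc i) \<longleftrightarrow> uncovered s B i"
    unfolding M
  proof (rule shadow_enumeration)
    fix h assume h: "bij_betw h {..<card B} B" "finite (nsets {1..n} s)"
      "\<And>j. j < card B \<Longrightarrow> nsets (h j) s \<subseteq> nsets {1..n} s"
      "\<And>j. j < card B \<Longrightarrow> nsets (h j) s \<noteq> {}"
      "\<And>j l. j < card B \<Longrightarrow> l < card B \<Longrightarrow> nsets (h j) s \<subseteq> nsets (h l) s \<Longrightarrow> j = l"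
      "(shadow_ideal s n B :: (nat set, 'a) mpoly set) =
        Idl\<^bsub>poly_ring (nsets {1..n} s)\<^esub> ((\<lambda>j. sqfree_term (nsets (h j) s)) ` {..<card B})"
      "\<And>i. irredundant (\<lambda>j. nsets (h j) s) (card B) (Suc i) \<longleftrightarrow> uncovered s B i"
    show thesis by (rule that[of h, unfolded M]) (fact h)+
  qed
  note b = betti_squarefree_0[OF h(2-6)] betti_squarefree_eq[OF h(2-6)]
    betti_squarefree_irredundant[OF h(2-6)]
  show "betti (nsets {1..n} s) M i = card B choose i" if "\<And>j. j \<le> i \<Longrightarrow> uncovered s B j"
    using b(1) b(2)[of "i - 1"] that h(7) by (cases i) auto
  show "uncovered s B i" if "1 \<le> i" "betti (nsets {1..n} s) M i = card B choose i"
    using b(3)[of "i - 1"] that h(7) by (cases i) auto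
qed

end


section \<open>Counting\<close>

lemma nsets_Int: "nsets A s \<inter> nsets B s = nsets (A \<inter> B) s"
  by (auto simp: nsets_def)

lemma insert_in_nsets: "A \<in> nsets X s \<Longrightarrow> x \<in> Y - A \<Longrightarrow> X \<subseteq> Y \<Longrightarrow> insert x A \<in> nsets Y (Suc s)"
  by (auto simp: nsets_def)

lemma card_supersets:
  assumes "finite X" "A \<in> nsets Y s" "X \<inter> A = {}"
  shows "card ((\<lambda>x. insert x A) ` X) = card X"
  using assms by (intro card_image) (auto simp: inj_on_def)

context
  fixes t k n :: nat and B :: "nat set set"
  assumes tk: "2 \<le> t" "t < k" "k < n" and B: "B \<subseteq> nsets {1..n} k"
begin

lemma block: "b \<in> B \<Longrightarrow> finite b \<and> card b = k \<and> b \<subseteq> {1..n}"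
  using B by (auto simp: nsets_def)

lemma finite_blocks: "finite B"
  using B finite_imp_finite_nsets[of "{1..n}" k] finite_subset by blast

text \<open>The t-sets inside the blocks partition all t-sets.\<close>

lemma steiner_system_card:
  assumes "steiner_system t k n B"
  shows "card B * (k choose t) = n choose t"
proof -
  have ex1: "\<And>T. T \<in> nsets {1..n} t \<Longrightarrow> \<exists>!b. b \<in> B \<and> T \<subseteq> b"
    using assms by (simp add: steiner_system_def)
  have "nsets {1..n} t = (\<Union>b\<in>B. nsets b t)"
  proof
    show "nsets {1..n} t \<subseteq> (\<Union>b\<in>B. nsets b t)"
    proof
      fix T assume T: "T \<in> nsets {1..n} t"
      then obtain b where "b \<in> B" "T \<subseteq> b" using ex1 by blast
      then show "T \<in> (\<Union>b\<in>B. nsets b t)" using T by (auto simp: nsets_def)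
    qed
    show "(\<Union>b\<in>B. nsets b t) \<subseteq> nsets {1..n} t"
      using block by (auto simp: nsets_def)
  qed
  moreover have "card (\<Union>b\<in>B. nsets b t) = (\<Sum>b\<in>B. card (nsets b t))"
  proof (rule card_UN_disjoint[OF finite_blocks])
    show "\<forall>b\<in>B. finite (nsets b t)" using block by (simp add: finite_imp_finite_nsets)
    show "\<forall>b\<in>B. \<forall>c\<in>B. b \<noteq> c \<longrightarrow> nsets b t \<inter> nsets c t = {}"
    proof (intro ballI impI, rule ccontr)
      fix b c assume bc: "b \<in> B" "c \<in> B" "b \<noteq> c" and "nsets b t \<inter> nsets c t \<noteq> {}"
      then obtain T where "T \<in> nsets b t" "T \<in> nsets c t" by blast
      moreover from this have "T \<in> nsets {1..n} t" using block[OF bc(1)] by (auto simp: nsets_def)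
      ultimately show False using ex1[of T] bc by (auto simp: nsets_def)
    qed
  qed
  moreover have "(\<Sum>b\<in>B. card (nsets b t)) = card B * (k choose t)"
    using block by (simp add: card_nsets)
  ultimately show ?thesis by (metis card_atLeastAtMost card_nsets diff_Suc_1 finite_atLeastAtMost)
qed

lemma steiner_system_uncovered:
  assumes st: "steiner_system t k n B" and i: "i < k choose (t - 1)"
  shows "uncovered (t - 1) B i"
  unfolding uncovered_def
proof (intro ballI allI impI notI)
  fix b S assume b: "b \<in> B" and S: "S \<subseteq> B - {b}" "card S = i"
    and cov: "nsets b (t - 1) \<subseteq> (\<Union>c\<in>S. nsets c (t - 1))"
  have "finite S" using S finite_blocks finite_subset by blast
  \<comment> \<open>Two blocks sharing t points would put one t-set into both.\<close>
  have meet: "card (b \<inter> c) \<le> t - 1" if "c \<in> S" for c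
  proof (rule ccontr)
    assume "\<not> card (b \<inter> c) \<le> t - 1"
    then have "t \<le> card (b \<inter> c)" by linarith
    then obtain T where T: "T \<subseteq> b \<inter> c" "card T = t" "finite T"
      by (rule obtain_subset_with_card_n)
    then have "T \<in> nsets {1..n} t" using block[OF b] by (auto simp: nsets_def)
    moreover have "c \<in> B" "c \<noteq> b" using S that by auto
    ultimately show False using st T b unfolding steiner_system_def by blast
  qed
  have "k choose (t - 1) = card (nsets b (t - 1))" using block[OF b] by (simp add: card_nsets)
  also have "\<dots> = card (\<Union>c\<in>S. nsets (b \<inter> c) (t - 1))"
  proof -
    have "nsets b (t - 1) = (\<Union>c\<in>S. nsets (b \<inter> c) (t - 1))"
      using cov nsets_Int[of b "t - 1"] by blast
    then show ?thesis by simp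
  qed
  also have "\<dots> \<le> (\<Sum>c\<in>S. card (nsets (b \<inter> c) (t - 1)))" by (rule card_UN_le[OF \<open>finite S\<close>])
  also have "\<dots> \<le> (\<Sum>c\<in>S. 1)"
  proof (rule sum_mono)
    fix c assume c: "c \<in> S"
    have "card (nsets (b \<inter> c) (t - 1)) = card (b \<inter> c) choose (t - 1)"
      using block[OF b] by (simp add: card_nsets)
    also have "\<dots> \<le> (t - 1) choose (t - 1)" by (rule binomial_right_mono[OF meet[OF c]])
    finally show "card (nsets (b \<inter> c) (t - 1)) \<le> 1" by simp
  qed
  finally show False using i S by simp
qed

section \<open>From uncovered shadows back to Steiner systems\<close>

definition exclusive :: "nat set \<Rightarrow> nat set \<Rightarrow> bool" where
  "exclusive b A \<longleftrightarrow> A \<in> nsets b (t - 1) \<and> (\<forall>c\<in>B. A \<subseteq> c \<longrightarrow> c = b)"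

text \<open>Without an exclusive set, every (t-1)-set of \<open>b\<close> lies in another block. If
  \<open>c\<close> shared t points with \<open>b\<close>, then \<open>c\<close> together with one
  block for each (t-1)-set of \<open>b\<close> outside \<open>c\<close> would cover the shadow of
  \<open>b\<close> with too few blocks.\<close>

lemma uncovered_cases:
  assumes unc: "\<And>i. 1 \<le> i \<Longrightarrow> i < k choose (t - 1) \<Longrightarrow> uncovered (t - 1) B i"
    and b: "b \<in> B" and np: "\<nexists>A. exclusive b A" and c: "c \<in> B" "c \<noteq> b"
  shows "card (b \<inter> c) < t"
proof (rule ccontr)
  assume le: "\<not> card (b \<inter> c) < t"
  let ?s = "t - 1" and ?d = "k choose (t - 1)"
  have "\<forall>A\<in>nsets b ?s. \<exists>c\<in>B. A \<subseteq> c \<and> c \<noteq> b" using np by (auto simp: exclusive_def)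
  then obtain f where f: "\<And>A. A \<in> nsets b ?s \<Longrightarrow> f A \<in> B \<and> A \<subseteq> f A \<and> f A \<noteq> b" by metis
  define S where "S = insert c (f ` (nsets b ?s - nsets (b \<inter> c) ?s))"
  have fin: "finite (nsets b ?s)" using block[OF b] by (simp add: finite_imp_finite_nsets)
  have sub: "nsets (b \<inter> c) ?s \<subseteq> nsets b ?s" by (auto simp: nsets_def)
  \<comment> \<open>The shared t-set alone contains t sets of size t - 1. As t is at least 2, using
    \<open>c\<close> saves at least one block, which brings the cover below
    \<open>?d\<close>.\<close>
  have "t = t choose ?s" using tk binomial_symmetric[of ?s t] by simp
  also have "\<dots> \<le> card (nsets (b \<inter> c) ?s)"
    using le block[OF b] by (simp add: card_nsets binomial_right_mono)
  finally have two: "2 \<le> card (nsets (b \<inter> c) ?s)" using tk by simp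
  have d: "card (nsets b ?s) = ?d" using block[OF b] by (simp add: card_nsets)
  have "card S \<le> Suc (card (nsets b ?s - nsets (b \<inter> c) ?s))"
    unfolding S_def using fin card_image_le[of "nsets b ?s - nsets (b \<inter> c) ?s" f]
    by (simp add: card_insert_if)
  also have "card (nsets b ?s - nsets (b \<inter> c) ?s) = ?d - card (nsets (b \<inter> c) ?s)"
    using sub fin d by (simp add: card_Diff_subset finite_subset)
  finally have "card S < ?d"
    using two card_mono[OF fin sub] d by linarith
  moreover have "1 \<le> card S"
  proof -
    have "finite S" "S \<noteq> {}" using fin by (auto simp: S_def)
    then show ?thesis using card_gt_0_iff[of S] by linarith
  qed
  moreover have "S \<subseteq> B - {b}" using f c by (auto simp: S_def)
  moreover have "nsets b ?s \<subseteq> (\<Union>c\<in>S. nsets c ?s)"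
  proof
    fix A assume A: "A \<in> nsets b ?s"
    show "A \<in> (\<Union>c\<in>S. nsets c ?s)"
    proof (cases "A \<subseteq> c")
      case True
      then show ?thesis using A by (auto simp: S_def nsets_def)
    next
      case False
      then have "f A \<in> S" using A by (auto simp: S_def nsets_def)
      moreover have "A \<in> nsets (f A) ?s" using f[OF A] A by (auto simp: nsets_def)
      ultimately show ?thesis by blast
    qed
  qed
  ultimately show False using unc[of "card S"] b by (auto simp: uncovered_def)
qed

text \<open>Count \<open>t\<close>-sets. A block with an exclusive \<open>(t-1)\<close>-set \<open>A\<close> is the only block containing the
  \<open>k - t + 1\<close> sets \<open>A \<union> {x}\<close> inside it, while the \<open>n - k\<close> sets \<open>A \<union> {x}\<close> sticking out lie in no
  block, and each such set arises from at most \<open>t\<close> blocks. A block without exclusive \<open>(t-1)\<close>-set is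
  the only block containing each of its \<open>t\<close>-sets. By the bound on \<open>n\<close>, the first kind
  of block uses up more than its share \<open>binom(k, t)\<close>.\<close>
lemma steiner_system_of_uncovered:
  assumes n: "int n > int k + int t * (int (k choose t) - int k + int t - 1)"
    and card_B: "card B * (k choose t) = n choose t"
    and unc: "\<And>i. 1 \<le> i \<Longrightarrow> i < k choose (t - 1) \<Longrightarrow> uncovered (t - 1) B i"
  shows "steiner_system t k n B"
proof -
  define B1 where "B1 = {b\<in>B. \<exists>A. exclusive b A}"
  define A where "A b = (SOME A. exclusive b A)" for b
  have A: "exclusive b (A b)" if "b \<in> B1" for b
    using that someI_ex[of "exclusive b"] by (auto simp: B1_def A_def)
  have A_nsets: "A b \<in> nsets b (t - 1)" if "b \<in> B1" for b using A[OF that] by (simp add: exclusive_def)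
  have B1B: "B1 \<subseteq> B" "finite B1" using finite_blocks by (auto simp: B1_def)
  have t1: "Suc (t - Suc 0) = t" using tk by simp
  define P where "P b = (if b \<in> B1 then (\<lambda>x. insert x (A b)) ` (b - A b) else nsets b t)" for b
  define Z where "Z = (\<Union>b\<in>B1. (\<lambda>x. insert x (A b)) ` ({1..n} - b))"
  have P_nsets: "P b \<subseteq> nsets b t" for b
    using insert_in_nsets[OF A_nsets, of b _ b] by (auto simp: P_def t1)
  have P_unique: "c = b" if "b \<in> B" "T \<in> P b" "c \<in> B" "T \<subseteq> c" for b c T
  proof (cases "b \<in> B1")
    case True
    then show ?thesis using that A[OF True] by (auto simp: P_def exclusive_def)
  next
    case False
    then have np: "\<nexists>A. exclusive b A" using that by (auto simp: B1_def)
    have "T \<in> nsets b t" using that P_nsets by blast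
    then have T: "T \<subseteq> b \<inter> c" "card T = t" using that by (auto simp: nsets_def)
    have "t \<le> card (b \<inter> c)" using T block[OF that(1)] card_mono[of "b \<inter> c" T] by auto
    then show ?thesis using uncovered_cases[OF unc that(1) np that(3)] by force
  qed
  \<comment> \<open>A block containing \<open>T\<close> contains the exclusive set
    \<open>A b\<close>, hence is \<open>b\<close>; but \<open>T\<close> has a point outside
    \<open>b\<close>.\<close>
  have Z_out: "\<not> T \<subseteq> c" if "T \<in> Z" "c \<in> B" for T c
    using that A by (auto simp: Z_def exclusive_def)
  have fin_t: "finite (nsets {1..n} t)" by (simp add: finite_imp_finite_nsets)
  have Z_nsets: "Z \<subseteq> nsets {1..n} t"
  proof
    fix T assume "T \<in> Z"
    then obtain b x where b: "b \<in> B1" "x \<in> {1..n} - b" "T = insert x (A b)" by (auto simp: Z_def)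
    have "A b \<subseteq> b" "b \<subseteq> {1..n}" using A_nsets[OF b(1)] block B1B b(1) by (auto simp: nsets_def)
    then show "T \<in> nsets {1..n} t"
      using insert_in_nsets[OF A_nsets[OF b(1)], of x "{1..n}"] b by (auto simp: t1)
  qed
  have UP: "(\<Union>b\<in>B. P b) \<subseteq> nsets {1..n} t"
  proof (intro UN_least)
    fix b assume "b \<in> B"
    then have "nsets b t \<subseteq> nsets {1..n} t" using block by (auto simp: nsets_def)
    then show "P b \<subseteq> nsets {1..n} t" using P_nsets by blast
  qed
  have fin_P: "finite (P b)" if "b \<in> B" for b
    using P_nsets[of b] block[OF that] finite_imp_finite_nsets[of b t] finite_subset by metis
  have card_P: "card (P b) = (if b \<in> B1 then k - (t - 1) else k choose t)" if "b \<in> B" for b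
  proof (cases "b \<in> B1")
    case True
    have "card (b - A b) = k - (t - 1)"
      using A_nsets[OF True] block[OF that] by (auto simp: nsets_def card_Diff_subset)
    then show ?thesis
      using True card_supersets[OF _ A_nsets[OF True], of "b - A b"] block[OF that] by (auto simp: P_def)
  next
    case False
    then show ?thesis using block[OF that] by (simp add: P_def card_nsets)
  qed
  have card_UP: "card (\<Union>b\<in>B. P b) = (\<Sum>b\<in>B. card (P b))"
  proof (rule card_UN_disjoint[OF finite_blocks])
    show "\<forall>b\<in>B. finite (P b)" using fin_P by blast
    show "\<forall>b\<in>B. \<forall>c\<in>B. b \<noteq> c \<longrightarrow> P b \<inter> P c = {}"
    proof (intro ballI impI, rule ccontr)
      fix b c assume bc: "b \<in> B" "c \<in> B" "b \<noteq> c" "P b \<inter> P c \<noteq> {}"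
      then obtain T where T: "T \<in> P b" "T \<in> P c" by blast
      then have "T \<in> nsets c t" using P_nsets by blast
      then have "T \<subseteq> c" by (simp add: nsets_def)
      then show False using P_unique[OF bc(1) T(1) bc(2)] bc by simp
    qed
  qed
  have sum_P: "(\<Sum>b\<in>B. card (P b)) = card B1 * (k - (t - 1)) + (card B - card B1) * (k choose t)"
  proof -
    have "(\<Sum>b\<in>B. card (P b)) = (\<Sum>b\<in>B1. card (P b)) + (\<Sum>b\<in>B - B1. card (P b))"
      using sum.subset_diff[OF B1B(1) finite_blocks, of "\<lambda>b. card (P b)"] by simp
    also have "(\<Sum>b\<in>B1. card (P b)) = card B1 * (k - (t - 1))"
      using card_P B1B by (simp add: subset_iff)
    also have "(\<Sum>b\<in>B - B1. card (P b)) = (card B - card B1) * (k choose t)"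
      using card_P B1B by (simp add: card_Diff_subset)
    finally show ?thesis .
  qed
  have "(\<Union>b\<in>B. P b) \<inter> Z = {}"
  proof (rule ccontr)
    assume "(\<Union>b\<in>B. P b) \<inter> Z \<noteq> {}"
    then obtain T b where T: "b \<in> B" "T \<in> P b" "T \<in> Z" by blast
    then have "T \<in> nsets b t" using P_nsets by blast
    then show False using Z_out[of T b] T by (simp add: nsets_def)
  qed
  then have "card (\<Union>b\<in>B. P b) + card Z = card ((\<Union>b\<in>B. P b) \<union> Z)"
    using UP Z_nsets fin_t finite_subset by (metis card_Un_disjoint)
  also have "\<dots> \<le> n choose t"
    using card_mono[OF fin_t, of "(\<Union>b\<in>B. P b) \<union> Z"] UP Z_nsets by (simp add: card_nsets)
  finally have count: "card B1 * (k - (t - 1)) + (card B - card B1) * (k choose t) + card Z \<le>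
      card B * (k choose t)" using card_UP sum_P card_B by simp
  have Z_count: "card B1 * (n - k) \<le> t * card Z"
  proof -
    \<comment> \<open>Pairs of a block and a set sticking out of it are counted through
      \<open>T\<close>: \<open>A b\<close> is one of the t subsets of \<open>T\<close> of size t -
      1, and being exclusive it determines \<open>b\<close>.\<close>
    define R where "R = (SIGMA b:B1. (\<lambda>x. insert x (A b)) ` ({1..n} - b))"
    have "card R = (\<Sum>b\<in>B1. card ((\<lambda>x. insert x (A b)) ` ({1..n} - b)))"
      unfolding R_def using B1B by (intro card_SigmaI) auto
    also have "\<dots> = (\<Sum>b\<in>B1. n - k)"
    proof (rule sum.cong[OF refl])
      fix b assume b: "b \<in> B1"
      then have "card ({1..n} - b) = n - k" using B1B block by (auto simp: card_Diff_subset)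
      then show "card ((\<lambda>x. insert x (A b)) ` ({1..n} - b)) = n - k"
        using card_supersets[OF _ A_nsets[OF b], of "{1..n} - b"] A_nsets[OF b] by (auto simp: nsets_def)
    qed
    finally have card_R: "card R = card B1 * (n - k)" by simp
    have "(\<lambda>(b, T). (T, A b)) ` R \<subseteq> (SIGMA T:Z. nsets T (t - 1))"
      using A_nsets by (auto simp: R_def Z_def nsets_def)
    moreover have "inj_on (\<lambda>(b, T). (T, A b)) R"
    proof (rule inj_onI)
      fix p p' assume p: "p \<in> R" "p' \<in> R" "(\<lambda>(b, T). (T, A b)) p = (\<lambda>(b, T). (T, A b)) p'"
      obtain b T b' where b: "p = (b, T)" "p' = (b', T)" "A b = A b'"
        using p(3) by (cases p, cases p') auto
      then have "b \<in> B1" "b' \<in> B1" using p by (auto simp: R_def)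
      moreover from this have "A b \<subseteq> b'" using A_nsets[of b'] b(3) by (simp add: nsets_def)
      ultimately have "b = b'" using A[of b] B1B by (auto simp: exclusive_def)
      then show "p = p'" using b by simp
    qed
    moreover have finZ: "finite Z" using Z_nsets fin_t finite_subset by blast
    moreover have ZT: "finite T \<and> card T = t" if "T \<in> Z" for T
      using Z_nsets that by (auto simp: nsets_def)
    then have "finite (SIGMA T:Z. nsets T (t - 1))"
      using finZ by (intro finite_SigmaI finite_imp_finite_nsets) auto
    ultimately have "card R \<le> card (SIGMA T:Z. nsets T (t - 1))"
      by (metis card_inj_on_le)
    also have "\<dots> = (\<Sum>T\<in>Z. card (nsets T (t - 1)))"
      using finZ ZT by (intro card_SigmaI) (auto simp: finite_imp_finite_nsets)
    also have "\<dots> = (\<Sum>T\<in>Z. t)"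
    proof (rule sum.cong[OF refl])
      fix T assume "T \<in> Z"
      then show "card (nsets T (t - 1)) = t"
        using ZT[of T] tk binomial_symmetric[of "t - 1" t] by (simp add: card_nsets)
    qed
    finally show ?thesis using card_R by (simp add: mult.commute)
  qed
  have B1_le: "card B1 \<le> card B" using B1B finite_blocks by (simp add: card_mono)
  have "B1 = {}"
  proof (rule ccontr)
    assume "B1 \<noteq> {}"
    then have pos: "0 < int (card B1)" using B1B by (simp add: card_gt_0_iff)
    have "(card B - card B1) * (k choose t) + card B1 * (k choose t) = card B * (k choose t)"
      using B1_le by (simp add: add_mult_distrib[symmetric])
    then have "card B1 * (k - (t - 1)) + card Z \<le> card B1 * (k choose t)" using count by linarith
    then have "t * (card B1 * (k - (t - 1))) + t * card Z \<le> t * (card B1 * (k choose t))"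
      by (metis add_mult_distrib2 mult_le_mono2)
    then have "t * (card B1 * (k - (t - 1))) + card B1 * (n - k) \<le> t * (card B1 * (k choose t))"
      using Z_count by linarith
    then have "card B1 * (t * (k - (t - 1)) + (n - k)) \<le> card B1 * (t * (k choose t))"
      by (simp add: algebra_simps)
    \<comment> \<open>Cancelling the positive \<open>card B1\<close> leaves the negation of the
      bound on n.\<close>
    then have "t * (k - (t - 1)) + (n - k) \<le> t * (k choose t)" using pos by simp
    then have "int (t * (k - (t - 1)) + (n - k)) \<le> int (t * (k choose t))" by (simp only: of_nat_le_iff)
    then have "int t * (int k - int t + 1) + (int n - int k) \<le> int t * int (k choose t)"
    proof -
      have "int (k - (t - 1)) = int k - int t + 1" "int (n - k) = int n - int k" using tk by auto
      then show ?thesis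
        using \<open>int (t * (k - (t - 1)) + (n - k)) \<le> int (t * (k choose t))\<close>
        by (simp only: of_nat_add of_nat_mult)
    qed
    then show False using n by (simp add: algebra_simps)
  qed
  \<comment> \<open>Now every block keeps all its t-sets. These families are disjoint and have
    binom(n, t) members in total, so they exhaust the t-sets.\<close>
  then have P: "P b = nsets b t" for b by (simp add: P_def)
  have "card (\<Union>b\<in>B. P b) = card (nsets {1..n} t)"
    using card_UP sum_P card_B \<open>B1 = {}\<close> by (simp add: card_nsets)
  then have all: "(\<Union>b\<in>B. nsets b t) = nsets {1..n} t"
    using card_subset_eq[OF fin_t UP] by (simp add: P)
  have "\<exists>!b. b \<in> B \<and> T \<subseteq> b" if T: "T \<in> nsets {1..n} t" for T
  proof -
    obtain b where b: "b \<in> B" "T \<in> nsets b t" using T all by blast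
    have "T \<subseteq> b" using b(2) by (simp add: nsets_def)
    moreover have "T \<in> P b" using b(2) by (simp add: P)
    ultimately show ?thesis using b(1) P_unique by metis
  qed
  then show ?thesis using B by (simp add: steiner_system_def)
qed

end


theorem corollary5p3:
  fixes t k n :: nat and B :: "nat set set" and M :: "(nat set, 'a::field) mpoly set" and p :: real
  assumes "2 \<le> t" and "t < k" and "k < n"
    and "int n > int k + int t * (int (k choose t) - int k + int t - 1)"
    and "B \<subseteq> nsets {1..n} k"
    and "p = real (n choose t) / real (k choose t)"
    and "M = shadow_ideal (t - 1) n B"
  shows "steiner_system t k n B \<longleftrightarrow>
    (\<forall>i \<in> {0..(k choose (t - 1)) - 1}.
       real (betti (nsets {1..n} (t - 1)) M i) = p gchoose i)"
proof -
  let ?V = "nsets {1..n} (t - 1)" and ?d = "k choose (t - 1)"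
  have s: "1 \<le> t - 1" "t - 1 \<le> k" using assms by auto
  have kt: "0 < k choose t" using assms by simp
  \<comment> \<open>Ensures that the index 1 belongs to the range of i.\<close>
  have d: "2 \<le> ?d"
  proof -
    obtain k' s' where "k = Suc k'" "t - 1 = Suc s'"
      using s assms by (metis Suc_le_D One_nat_def less_imp_Suc_add)
    moreover have "0 < k' choose s'" "0 < k' choose Suc s'" using calculation assms by auto
    then have "2 \<le> (k' choose s') + (k' choose Suc s')" by linarith
    ultimately show ?thesis by simp
  qed
  have p: "real (card B) = p \<longleftrightarrow> card B * (k choose t) = n choose t"
  proof -
    have "real (card B) = p \<longleftrightarrow> real (card B) * real (k choose t) = real (n choose t)"
      using kt by (auto simp: assms(6) field_simps)
    then show ?thesis by (simp only: of_nat_mult[symmetric] of_nat_eq_iff)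
  qed
  note unc = betti_shadow_ideal_eq[OF s assms(5,7)]
    betti_shadow_ideal_uncovered[OF s assms(5,7)]
  show ?thesis
  proof
    assume st: "steiner_system t k n B"
    have u: "uncovered (t - 1) B i" if "i < ?d" for i
      using steiner_system_uncovered[OF assms(1,2,3,5) st that] .
    have "real (card B) = p" using p steiner_system_card[OF assms(1,2,3,5) st] by blast
    moreover have "betti ?V M i = card B choose i" if "i < ?d" for i
      using unc(1)[of i] u that by simp
    ultimately show "\<forall>i\<in>{0..?d - 1}. real (betti ?V M i) = p gchoose i"
      using d by (auto simp: binomial_gbinomial)
  next
    assume R: "\<forall>i\<in>{0..?d - 1}. real (betti ?V M i) = p gchoose i"
    \<comment> \<open>The equality at i = 1 identifies p with \<open>card B\<close>; from then on
      \<open>gchoose\<close> is an ordinary binomial coefficient, and the remaining equalities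
      compare with Taylor ranks.\<close>
    have "uncovered (t - 1) B 0" "uncovered (t - 1) B 1"
      using uncovered_small[OF s assms(5)] by auto
    then have "uncovered (t - 1) B j" if "j \<le> 1" for j
      using that by (cases j) auto
    from unc(1)[OF this] have "betti ?V M 1 = card B" by simp
    then have cB: "real (card B) = p" using R[rule_format, of 1] d by simp
    have "uncovered (t - 1) B i" if "1 \<le> i" "i < ?d" for i
    proof (rule unc(2)[OF that(1)])
      have "real (betti ?V M i) = real (card B choose i)"
        using R[rule_format, of i] that by (simp add: cB[symmetric] binomial_gbinomial)
      then show "betti ?V M i = card B choose i" by simp
    qed
    then show "steiner_system t k n B"
      using steiner_system_of_uncovered[OF assms(1,2,3,5,4)] p cB by blast
  qed
qed

end
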